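(* For every positive integer $s$ there exists some $c=c(s)>0$ such that \[ \bigl\lVert \mathrm e(\vartheta g_\lambda)\bigr\rVert_{U^s(\mathbb T)}^{2^s}\ll_s\exp\bigl(-c\,\lambda\,\lVert\vartheta\rVert^2\bigr) \] for $\lambda\to\infty$, uniformly in $\vartheta\in\mathbb R$ (the implied constant depending only on $s$).
   Context: $\mathrm e(x)=\exp(2\pi ix)$; $\lVert\vartheta\rVert$ is the distance from $\vartheta$ to the nearest integer; $\{x\}=x-\lfloor x\rfloor$; $\gamma=(\sqrt5+1)/2$; $\mathbb T=\mathbb R/\mathbb Z$. Fibonacci numbers: $F_0=0$, $F_1=1$, $F_{i+2}=F_{i+1}+F_i$. Every nonnegative integer $n$ has a unique (Zeckendorf) representation $n=\sum_{i\ge 2}\delta_i(n)F_i$ (finite sum) with $\delta_i(n)\in\{0,1\}$ and such that $\delta_{i+1}(n)=1$ implies $\delta_i(n)=0$ for all $i\ge2$. Definition of $g_\lambda$: for $x\in[0,1)$ of the form $x=\{n\gamma\}$ with $n$ a nonnegative integer, and $i\ge2$, put $\widetilde\delta_i(x)=\delta_i(n)$. For $x\in[0,1)$ put $\delta_i'(x)=\lim_{z\to x+}\widetilde\delta_i(z)$ (limit from the right along points $z$ of the form $\{n\gamma\}$; this limit exists), and extend $\delta_i'$ to a $1$-periodic function on $\mathbb R$; it is piecewise constant. Set $g_\lambda(x)=\sum_{i=2}^\lambda\delta_i'(x)$. Gowers norm: for an integrable $1$-periodic $f:\mathbb R\to\mathbb C$, \[ \lVert f\rVert_{U^s(\mathbb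 T)}^{2^s}=\int_{[0,1]}\int_{[0,1]^s}\ \prod_{\varepsilon_1,\dots,\varepsilon_s\in\{0,1\}}\mathcal C^{\varepsilon_1+\cdots+\varepsilon_s}f\Bigl(x+\sum_{1\le i\le s}y_i\varepsilon_i\Bigr)\,\mathrm d(y_1,\dots,y_s)\,\mathrm dx, \] where $\mathcal C$ denotes complex conjugation. *)

theory Defs
  imports "HOL-Analysis.Analysis" "HOL-Number_Theory.Fib"
begin

definition e :: "real \<Rightarrow> complex" where
  "e x = exp (2 * of_real pi * \<i> * of_real x)"

definition dist_nearest_int :: "real \<Rightarrow> real" where
  "dist_nearest_int \<theta> = \<bar>\<theta> - of_int (round \<theta>)\<bar>"

definition golden :: real where
  "golden = (sqrt 5 + 1) / 2"


text \<open>The digits at positions 0 and 1, which do not occur in a Zeckendorf representation, are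
  set to 0, so that the digit sequence of a number is unique as a function on all indices.\<close>

definition is_zeckendorf :: "nat \<Rightarrow> (nat \<Rightarrow> nat) \<Rightarrow> bool" where
  "is_zeckendorf n d \<longleftrightarrow>
     (\<forall>i. d i \<in> {0, 1}) \<and> (\<forall>i<2. d i = 0) \<and> finite {i. d i \<noteq> 0} \<and>
     (\<forall>i\<ge>2. d (i + 1) = 1 \<longrightarrow> d i = 0) \<and>
     n = (\<Sum>i | d i \<noteq> 0. d i * fib i)"

definition zeck_digit :: "nat \<Rightarrow> nat \<Rightarrow> nat" where
  "zeck_digit i n = (THE d. is_zeckendorf n d) i"


definition golden_points :: "real set" where
  "golden_points = range (\<lambda>n::nat. frac (of_nat n * golden))"

text \<open>The index n is determined by the point, since the golden ratio is irrational. The value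
  outside \<open>golden_points\<close> is irrelevant.\<close>

definition digit_tilde :: "nat \<Rightarrow> real \<Rightarrow> real" where
  "digit_tilde i x = of_nat (zeck_digit i (THE n::nat. x = frac (of_nat n * golden)))"

text \<open>Right limit along \<open>golden_points\<close>, which are dense in the unit interval; replacing x by
  its fractional part is the 1-periodic extension.\<close>

definition digit_prime :: "nat \<Rightarrow> real \<Rightarrow> real" where
  "digit_prime i x = Lim (at (frac x) within (golden_points \<inter> {frac x<..})) (digit_tilde i)"

definition g :: "nat \<Rightarrow> real \<Rightarrow> real" where
  "g L x = (\<Sum>i = 2..L. digit_prime i x)"


text \<open>The integral whose value is the \<open>2\<^sup>s\<close>-th power of the Gowers norm of a 1-periodic function.\<close>

definition gowers_integral :: "nat \<Rightarrow> (real \<Rightarrow> complex) \<Rightarrow> complex" where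
  "gowers_integral s f =
     (LINT x:{0..1}|lborel.
       (LINT y:({1..s} \<rightarrow>\<^sub>E {0..1})|(\<Pi>\<^sub>M i\<in>{1..s}. lborel).
         (\<Prod>\<epsilon>\<in>({1..s} \<rightarrow>\<^sub>E {0, 1::nat}).
           (cnj ^^ (\<Sum>i\<in>{1..s}. \<epsilon> i)) (f (x + (\<Sum>i\<in>{1..s}. y i * of_nat (\<epsilon> i)))))))"

text \<open>For a positive s the integral is a nonnegative real number, so the modulus serves only to
  pass from the complex to the real type, and the \<open>2\<^sup>s\<close>-th power of the norm is the integral.\<close>

definition gowers_norm :: "nat \<Rightarrow> (real \<Rightarrow> complex) \<Rightarrow> real" where
  "gowers_norm s f = root (2 ^ s) (cmod (gowers_integral s f))"

end

theory Submission
  imports Defs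
begin

text \<open>
Write \<open>psi = 1 / golden\<close>. The points with prescribed digits at the first positions form an
interval modulo 1, and the lengths of these intervals decrease like \<open>psi ^ k\<close>. Let \<open>k\<close> be odd;
then \<open>F\<^sub>k golden\<close> is congruent to \<open>psi ^ k\<close> modulo 1, and for most \<open>p\<close> the increment
\<open>g L (p + psi ^ k) - g L p\<close> depends only on the digits of \<open>p\<close> at positions close to \<open>k\<close>. It is
therefore locally constant there, and every interval of length comparable to \<open>psi ^ k\<close> contains a
point where it jumps by 1.

Replacing \<open>y\<close> by \<open>y + u (1, \<dots>, 1)\<close> in the Gowers integral, it suffices to bound, for all real
shifts \<open>r\<close>, the integral over \<open>x\<close> and \<open>u\<close> of the product of the factors
\<open>e (\<plusminus> \<theta> g L (x + c\<^sub>\<epsilon> u + r\<^sub>\<epsilon>))\<close>, where \<open>c\<^sub>\<epsilon>\<close> is the number of ones of \<open>\<epsilon>\<close>. Only the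
vertex \<open>\<epsilon> = 0\<close> does not move with \<open>u\<close>. In any square of side comparable to \<open>psi ^ k\<close> one
first fixes \<open>x\<close> near a jump for this vertex and then chooses \<open>u\<close> such that the increments at all
other vertices are constant nearby. On one of the two sides of the jump, a small box and its translate by
\<open>psi ^ k\<close> in the direction of \<open>x\<close> then carry phases that differ by \<open>v \<theta>\<close> with an integer \<open>v\<close> such
that \<open>v \<theta>\<close> has distance at least half of that of \<open>\<theta>\<close> to the integers. This saves a factor
\<open>1 - \<eta> d\<^sup>2\<close>, \<open>d\<close> the distance of \<open>\<theta>\<close> to the integers, each time the scale is reduced by a
fixed power of \<open>psi\<close>, and there are about \<open>L\<close> scales.
\<close>

section \<open>Zeckendorf representations\<close>

text \<open>If the digit at \<open>Suc k\<close> is 1, the one at \<open>k\<close> is 0, so the sum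
  stays below \<open>fib k + fib (Suc k)\<close>. This strict bound lets the leading digit decide
  the size of a number.\<close>

lemma zeckendorf_partial_sum_less:
  assumes "\<forall>i. d i \<in> {0, 1}" "\<forall>i<2. d i = 0" "\<forall>i\<ge>2. d (i + 1) = 1 \<longrightarrow> d i = 0" "0 < k"
  shows "(\<Sum>i<k. d i * fib i) < fib k"
  using assms(4)
proof (induction k rule: fib.induct)
  case (3 k)
  show ?case
  proof (cases "d (Suc k) = 0")
    case True
    have "(\<Sum>i<Suc k. d i * fib i) < fib (Suc k)" using 3(1) by simp
    also have "\<dots> \<le> fib (Suc (Suc k))" by (simp add: fib_mono)
    finally show ?thesis using True by simp
  next
    case False
    then have one: "d (Suc k) = 1" using assms(1) by (metis insertE singletonD)
    then have k: "k > 0" using assms(2) by (metis One_nat_def False Suc_1 lessI neq0_conv)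
    have z: "d k = 0"
    proof (cases "k \<ge> 2")
      case True
      then show ?thesis using one assms(3) by simp
    next
      case False
      then show ?thesis using assms(2) by simp
    qed
    have "(\<Sum>i<k. d i * fib i) < fib k" using 3(2) k by simp
    then show ?thesis using one z by simp
  qed
qed (use assms(2) in auto)

lemma zeckendorf_sum_lessThan:
  assumes "is_zeckendorf n d" "\<forall>i\<ge>k. d i = 0"
  shows "n = (\<Sum>i<k. d i * fib i)"
proof -
  have "n = (\<Sum>i | d i \<noteq> 0. d i * fib i)" using assms(1) unfolding is_zeckendorf_def by blast
  also have "\<dots> = (\<Sum>i<k. d i * fib i)"
  proof (rule sum.mono_neutral_left)
    show "{i. d i \<noteq> 0} \<subseteq> {..<k}" using assms(2) by (metis (mono_tags) lessThan_iff linorder_not_le mem_Collect_eq subsetI)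
  qed auto
  finally show ?thesis .
qed

text \<open>At the highest position \<open>p\<close> where the sequences differ, the digits above
  cancel, and those below \<open>p\<close> sum to less than \<open>fib p\<close>, so they cannot
  compensate for the extra \<open>fib p\<close>.\<close>

lemma zeckendorf_unique:
  assumes "is_zeckendorf n d" "is_zeckendorf n d'"
  shows "d = d'"
proof (rule ccontr)
  assume ne: "d \<noteq> d'"
  let ?D = "{i. d i \<noteq> d' i}"
  have fin: "finite ?D"
    by (rule finite_subset[of _ "{i. d i \<noteq> 0} \<union> {i. d' i \<noteq> 0}"])
       (use assms in \<open>auto simp: is_zeckendorf_def\<close>)
  define p where "p = Max ?D"
  have "?D \<noteq> {}" using ne by auto
  then have p: "d p \<noteq> d' p" using Max_in[OF fin] by (auto simp: p_def)
  have above: "d i = d' i" if "i > p" for i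
    using Max_ge[OF fin, of i] that by (fastforce simp: p_def)
  have main: False
    if z: "is_zeckendorf n a" "is_zeckendorf n b" and ab: "a p = 1" "b p = 0" "\<forall>i>p. a i = b i"
    for a b
  proof -
    have "finite ({i. a i \<noteq> 0} \<union> {i. b i \<noteq> 0})" using z by (auto simp: is_zeckendorf_def)
    then obtain K where K: "\<forall>i\<in>{i. a i \<noteq> 0} \<union> {i. b i \<noteq> 0}. i < K"
      using finite_nat_set_iff_bounded by blast
    have K0: "\<forall>i\<ge>K. a i = 0" "\<forall>i\<ge>K. b i = 0"
      using K by (metis (mono_tags) UnCI linorder_not_le mem_Collect_eq)+
    have pK: "p < K" using K0 ab(1) by (metis not_le zero_neq_one)
    then have split: "{..<K} = {..<p} \<union> {p} \<union> {p<..<K}" by auto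
    have S: "(\<Sum>i<K. f i) = (\<Sum>i<p. f i) + f p + (\<Sum>i\<in>{p<..<K}. f i)" for f :: "nat \<Rightarrow> nat"
      by (subst split, subst sum.union_disjoint) (auto simp: sum.union_disjoint)
    have "(\<Sum>i<K. a i * fib i) = (\<Sum>i<K. b i * fib i)"
      using zeckendorf_sum_lessThan[OF z(1) K0(1)] zeckendorf_sum_lessThan[OF z(2) K0(2)] by simp
    moreover have "(\<Sum>i\<in>{p<..<K}. a i * fib i) = (\<Sum>i\<in>{p<..<K}. b i * fib i)"
      using ab(3) by (intro sum.cong) auto
    ultimately have eq: "(\<Sum>i<p. a i * fib i) + fib p = (\<Sum>i<p. b i * fib i)"
      using S[of "\<lambda>i. a i * fib i"] S[of "\<lambda>i. b i * fib i"] ab by simp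
    have "p > 0" using ab(1) z(1) by (cases p) (auto simp: is_zeckendorf_def)
    then have "(\<Sum>i<p. b i * fib i) < fib p"
      by (intro zeckendorf_partial_sum_less) (use z(2) in \<open>auto simp: is_zeckendorf_def\<close>)
    with eq show False by linarith
  qed
  have "d p \<in> {0,1}" "d' p \<in> {0,1}" using assms by (auto simp: is_zeckendorf_def)
  then consider "d p = 1" "d' p = 0" | "d' p = 1" "d p = 0" using p by fastforce
  then show False
  proof cases
    case 1
    then show False using main[OF assms] above by blast
  next
    case 2
    then show False using main[OF assms(2,1)] above by metis
  qed
qed

lemma zeckendorf_eq_0:
  assumes "is_zeckendorf n d" "n < fib k" "k \<le> i"
  shows "d i = 0"
proof (rule ccontr)
  assume a: "d i \<noteq> 0"
  have fin: "finite {i. d i \<noteq> 0}" and n: "n = (\<Sum>i | d i \<noteq> 0. d i * fib i)"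
    using assms(1) unfolding is_zeckendorf_def by blast+
  have "fib i \<le> d i * fib i" using a by simp
  also have "\<dots> \<le> n" unfolding n using fin a by (intro member_le_sum) auto
  finally show False using assms(2) fib_mono[OF assms(3)] by linarith
qed

text \<open>\<open>N < fib k\<close> forces all digits from position \<open>k\<close> on to vanish,
  so a digit at \<open>k + 1\<close> has an empty neighbour on both sides.\<close>

lemma zeckendorf_insert:
  assumes "is_zeckendorf N d" "N < fib k" "1 \<le> k"
  shows "is_zeckendorf (N + fib (k + 1)) (d(k + 1 := 1))"
proof -
  have z: "d i = 0" if "k \<le> i" for i using zeckendorf_eq_0[OF assms(1,2)] that by blast
  let ?d = "d(k + 1 := 1)"
  have fin: "finite {i. d i \<noteq> 0}" and N: "N = (\<Sum>i | d i \<noteq> 0. d i * fib i)"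
    using assms(1) unfolding is_zeckendorf_def by blast+
  have supp: "{i. ?d i \<noteq> 0} = insert (k + 1) {i. d i \<noteq> 0}" by auto
  have "(\<Sum>i | ?d i \<noteq> 0. ?d i * fib i) = fib (k + 1) + (\<Sum>i | d i \<noteq> 0. ?d i * fib i)"
    unfolding supp using fin z[of "k+1"] by (subst sum.insert) auto
  also have "(\<Sum>i | d i \<noteq> 0. ?d i * fib i) = (\<Sum>i | d i \<noteq> 0. d i * fib i)"
    using z[of "k+1"] by (intro sum.cong) auto
  finally have sum: "N + fib (k + 1) = (\<Sum>i | ?d i \<noteq> 0. ?d i * fib i)" using N by linarith
  have "?d (i + 1) = 1 \<longrightarrow> ?d i = 0" if "i \<ge> 2" for i
  proof -
    have "d (i + 1) = 1 \<longrightarrow> d i = 0" using assms(1) that unfolding is_zeckendorf_def by blast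
    then show ?thesis using z by simp
  qed
  moreover have "\<forall>i. ?d i \<in> {0, 1}" "\<forall>i<2. ?d i = 0"
    using assms(1,3) unfolding is_zeckendorf_def by auto
  moreover have "finite {i. ?d i \<noteq> 0}" using fin supp by simp
  ultimately show ?thesis using sum unfolding is_zeckendorf_def by blast
qed

lemma less_fib: "n < fib (n + 2)"
proof (induction n)
  case (Suc n)
  have "fib (Suc n) > 0" by (simp add: fib_neq_0_nat)
  then show ?case using Suc by simp
qed simp

lemma zeckendorf_exists: "\<exists>d. is_zeckendorf n d"
proof -
  have "\<exists>d. is_zeckendorf n d" if "n < fib (Suc k)" for k
    using that
  proof (induction k arbitrary: n rule: less_induct)
    case (less k)
    consider "n = 0" | "n > 0" "k > 0" "n < fib k" | "n > 0" "fib k \<le> n"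
      using less.prems by (cases "k = 0") force+
    then show ?case
    proof cases
      case 1
      then have "is_zeckendorf n (\<lambda>_. 0)" by (simp add: is_zeckendorf_def)
      then show ?thesis by blast
    next
      case 2
      then show ?thesis using less.IH[of "k - 1" n] by auto
    next
      case 3
      have "k \<ge> 2"
        using 3 less.prems by (cases k rule: fib.cases) auto
      then obtain l where l: "k = Suc l" "l \<ge> 1" by (intro that[of "k - 1"]) auto
      \<comment> \<open>Greedy choice: taking off the largest possible \<open>fib k\<close> leaves
        less than \<open>fib (k - 1)\<close>, which keeps position \<open>k - 1\<close>
        free.\<close>
      have lt: "n - fib k < fib l" using less.prems 3 l by simp
      have "n - fib k < fib (Suc (l - 1))" using lt l by simp
      moreover have "l - 1 < k" using l by simp
      ultimately obtain d where "is_zeckendorf (n - fib k) d" using less.IH by blast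
      from zeckendorf_insert[OF this lt l(2)] show ?thesis using 3 l by auto
    qed
  qed
  moreover have "n < fib (Suc (n + 1))" using less_fib[of n] by simp
  ultimately show ?thesis by blast
qed

lemma is_zeckendorf_zeck_digit: "is_zeckendorf n (\<lambda>i. zeck_digit i n)"
proof -
  have "\<exists>!d. is_zeckendorf n d"
    by (rule ex_ex1I[OF zeckendorf_exists]) (rule zeckendorf_unique)
  then show ?thesis unfolding zeck_digit_def by (rule theI')
qed

lemma zeck_digit_eqI: "is_zeckendorf n d \<Longrightarrow> zeck_digit i n = d i"
  using zeckendorf_unique[OF is_zeckendorf_zeck_digit] by metis

lemma zeck_digit_eq_0: "n < fib k \<Longrightarrow> k \<le> i \<Longrightarrow> zeck_digit i n = 0"
  using zeckendorf_eq_0[OF is_zeckendorf_zeck_digit] by blast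

lemma zeck_digit_add_fib:
  assumes "N < fib k" "1 \<le> k"
  shows "zeck_digit i (N + fib (k + 1)) = (if i = k + 1 then 1 else zeck_digit i N)"
  using zeck_digit_eqI[OF zeckendorf_insert[OF is_zeckendorf_zeck_digit assms], of i] by simp

definition zeck_sum :: "nat \<Rightarrow> nat" where
  "zeck_sum n = card {i. zeck_digit i n \<noteq> 0}"

lemma zeck_sum_add_fib:
  assumes "N < fib k" "1 \<le> k"
  shows "zeck_sum (N + fib (k + 1)) = Suc (zeck_sum N)"
proof -
  have "{i. zeck_digit i (N + fib (k + 1)) \<noteq> 0} = insert (k + 1) {i. zeck_digit i N \<noteq> 0}"
    unfolding set_eq_iff insert_iff mem_Collect_eq zeck_digit_add_fib[OF assms] by simp
  moreover have "zeck_digit (k + 1) N = 0" using zeck_digit_eq_0[OF assms(1)] by simp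
  moreover have "finite {i. zeck_digit i N \<noteq> 0}"
    using is_zeckendorf_zeck_digit[of N] unfolding is_zeckendorf_def by blast
  ultimately show ?thesis by (simp add: zeck_sum_def)
qed

lemma zeck_sum_eq:
  assumes "N < fib (k + 1)"
  shows "(\<Sum>i = 2..k. zeck_digit i N) = zeck_sum N"
proof -
  have z: "\<forall>i. zeck_digit i N \<in> {0,1}" "\<forall>i<2. zeck_digit i N = 0"
    using is_zeckendorf_zeck_digit[of N] unfolding is_zeckendorf_def by blast+
  have sub: "{i. zeck_digit i N \<noteq> 0} \<subseteq> {2..k}"
  proof
    fix i assume "i \<in> {i. zeck_digit i N \<noteq> 0}"
    then have "\<not> i < 2" "\<not> k + 1 \<le> i" using z(2) zeck_digit_eq_0[OF assms, of i] by auto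
    then show "i \<in> {2..k}" by simp
  qed
  have "zeck_sum N = (\<Sum>i | zeck_digit i N \<noteq> 0. 1)" by (simp add: zeck_sum_def)
  also have "\<dots> = (\<Sum>i | zeck_digit i N \<noteq> 0. zeck_digit i N)"
  proof (intro sum.cong refl)
    fix i assume "i \<in> {i. zeck_digit i N \<noteq> 0}"
    moreover have "zeck_digit i N \<in> {0,1}" using z(1) ..
    ultimately show "1 = zeck_digit i N" by simp
  qed
  also have "\<dots> = (\<Sum>i = 2..k. zeck_digit i N)"
    using sub by (intro sum.mono_neutral_left) auto
  finally show ?thesis ..
qed

section \<open>Digits of a point of the circle\<close>

text \<open>\<open>- psi\<close> is the conjugate of \<open>golden\<close>, the other root of
  \<open>x^2 = x + 1\<close>; its powers therefore satisfy the Fibonacci recursion.\<close>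

definition psi :: real where "psi = golden - 1"

lemma golden_eq: "golden = 1 + psi"
  by (simp add: psi_def)

lemma psi_bounds: "0 < psi" "psi < 1"
proof -
  have "sqrt 1 < sqrt 5" "sqrt 5 < sqrt 9" unfolding real_sqrt_less_iff by simp_all
  moreover have "sqrt 9 = (3::real)" by (rule real_sqrt_unique) auto
  ultimately show "0 < psi" "psi < 1" unfolding psi_def golden_def by simp_all
qed

lemma psi_power_pos [simp]: "0 < psi ^ k"
  using psi_bounds by simp

lemma psi_sq: "psi\<^sup>2 = 1 - psi"
proof -
  have "(sqrt 5)\<^sup>2 = (5::real)" by simp
  then show ?thesis unfolding psi_def golden_def power2_eq_square by (simp add: field_simps)
qed

lemma psi_Suc_Suc: "psi ^ Suc (Suc k) = psi ^ k - psi ^ Suc k"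
proof -
  have "psi ^ Suc (Suc k) = psi ^ k * psi\<^sup>2" by (simp add: power2_eq_square mult.assoc)
  then show ?thesis by (simp add: psi_sq algebra_simps)
qed

lemma minus_psi_Suc_Suc: "(- psi) ^ Suc (Suc k) = (- psi) ^ k + (- psi) ^ Suc k"
proof -
  have "(- psi) ^ Suc (Suc k) = (- psi) ^ k * psi\<^sup>2" by (simp add: power2_eq_square mult.assoc)
  then show ?thesis by (simp add: psi_sq algebra_simps)
qed

lemma psi_Suc_less: "psi ^ Suc k < psi ^ k"
  using psi_bounds by (simp add: mult_less_cancel_right1)

text \<open>All three terms satisfy the Fibonacci recursion, so two initial values suffice. Modulo 1
  this replaces \<open>fib k * golden\<close> by a small number.\<close>

lemma fib_golden: "real (fib k) * golden = real (fib (Suc k)) - (- psi) ^ k"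
proof (induction k rule: fib.induct)
  case 2
  then show ?case by (simp add: golden_eq)
next
  case (3 k)
  then show ?case using minus_psi_Suc_Suc[of k] by (simp add: algebra_simps del: power_Suc)
qed simp

text \<open>Since \<open>F\<^sub>i golden\<close> is congruent to \<open>- (- psi)\<^sup>i\<close> modulo 1, the digits of a point are those
  of an expansion in base \<open>- golden\<close>. The set of all values \<open>- (\<Sum>i\<ge>k+2. \<delta>\<^sub>i (- psi)\<^sup>i)\<close>
  over admissible digit sequences is, up to the end points, the interval \<open>tail_ivl k\<close>.\<close>

definition tail_ivl :: "nat \<Rightarrow> real set" where
  "tail_ivl k = (if even k then {- (psi ^ (k + 1)) ..< psi ^ (k + 2)}
                 else {- (psi ^ (k + 2)) ..< psi ^ (k + 1)})"

text \<open>Everything is expressed by the two lengths \<open>a k\<close> and \<open>b k\<close>, so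
  that relations between three consecutive levels become linear arithmetic.\<close>

lemma tail_ivl_refine:
  defines "a \<equiv> \<lambda>k. psi ^ (k + 1)" and "b \<equiv> \<lambda>k. psi ^ (k + 2)"
  shows "tail_ivl k = (if even k then {- a k..<b k} else {- b k..<a k})"
    and "tail_ivl (Suc k) = (if even k then {b k - a k..<b k} else {- b k..<a k - b k})"
    and "tail_ivl (k + 2) = (if even k then {b k - a k..<2 * b k - a k}
                             else {a k - 2 * b k..<a k - b k})"
proof -
  have e: "psi ^ (Suc k + 1) = b k" "psi ^ (Suc k + 2) = a k - b k"
    "psi ^ (k + 2 + 1) = a k - b k" "psi ^ (k + 2 + 2) = 2 * b k - a k"
    using psi_Suc_Suc[of "k + 1"] psi_Suc_Suc[of "k + 2"] by (simp_all add: a_def b_def)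
  show "tail_ivl k = (if even k then {- a k..<b k} else {- b k..<a k})"
    by (simp add: tail_ivl_def a_def b_def)
  show "tail_ivl (Suc k) = (if even k then {b k - a k..<b k} else {- b k..<a k - b k})"
    unfolding tail_ivl_def e by simp
  show "tail_ivl (k + 2) = (if even k then {b k - a k..<2 * b k - a k}
                             else {a k - 2 * b k..<a k - b k})"
    unfolding tail_ivl_def e by simp
qed

text \<open>The digit at position \<open>k + 2\<close> is either 0, and the expansion continues at
  \<open>k + 3\<close>, or it is 1, which forces the next digit to be 0, and the expansion continues
  at \<open>k + 4\<close>. The half-open ends make the two cases exclusive.\<close>

lemma tail_ivl_split:
  "y \<in> tail_ivl k \<longleftrightarrow> y \<in> tail_ivl (Suc k) \<or> y + (- psi) ^ (k + 2) \<in> tail_ivl (k + 2)"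
  and tail_ivl_disjoint:
  "y \<in> tail_ivl (Suc k) \<Longrightarrow> y + (- psi) ^ (k + 2) \<notin> tail_ivl (k + 2)"
proof -
  have pos: "0 < psi ^ (k + 1)" "0 < psi ^ (k + 2)" "psi ^ (k + 2) < psi ^ (k + 1)"
      "psi ^ (k + 1) < 2 * psi ^ (k + 2)"
    using psi_Suc_less[of "k + 1"] psi_power_pos[of "k + 4"] psi_Suc_Suc[of "k + 1"]
      psi_Suc_Suc[of "k + 2"] psi_power_pos[of "k + 1"] psi_power_pos[of "k + 2"]
    by (simp_all add: eval_nat_numeral)
  have sign: "(- psi) ^ (k + 2) = (if even k then psi ^ (k + 2) else - (psi ^ (k + 2)))"
    by (cases "even k") simp_all
  show "y \<in> tail_ivl k \<longleftrightarrow> y \<in> tail_ivl (Suc k) \<or> y + (- psi) ^ (k + 2) \<in> tail_ivl (k + 2)"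
    unfolding tail_ivl_refine[of k] sign using pos by (cases "even k") auto
  show "y \<in> tail_ivl (Suc k) \<Longrightarrow> y + (- psi) ^ (k + 2) \<notin> tail_ivl (k + 2)"
    unfolding tail_ivl_refine[of k] sign using pos by (cases "even k") auto
qed

lemma zero_in_tail_ivl: "0 \<in> tail_ivl k"
  using psi_power_pos[of "k+1"] psi_power_pos[of "k+2"] unfolding tail_ivl_def
  by (auto simp del: psi_power_pos simp: less_imp_le)

lemma tail_ivl_bound: "y \<in> tail_ivl k \<Longrightarrow> \<bar>y\<bar> \<le> psi ^ (k + 1)"
  using psi_Suc_less[of "k + 1"] unfolding tail_ivl_def
  by (auto split: if_splits simp del: power_Suc)

text \<open>Here \<open>N\<close> collects the digits of \<open>x\<close> at the positions up to
  \<open>l + 1\<close>, and \<open>m\<close> is the integer translate. If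
  \<open>N < fib (l + 1)\<close>, the digit at \<open>l + 1\<close> is 0 and the tail starts at
  position \<open>l + 2\<close>; otherwise it is 1, position \<open>l + 2\<close> must stay empty
  and the tail starts at \<open>l + 3\<close>.\<close>

definition cell :: "nat \<Rightarrow> nat \<Rightarrow> int \<Rightarrow> real \<Rightarrow> bool" where
  "cell l N m x \<longleftrightarrow> N < fib (l + 2) \<and>
     x - of_int m - real N * golden \<in> tail_ivl (if N < fib (l + 1) then l else l + 1)"

lemma cell_Suc:
  assumes "cell l N m x"
  shows "cell (Suc l) N m x \<or>
    (N < fib (l + 1) \<and> cell (Suc l) (N + fib (l + 2)) (m - int (fib (l + 3))) x)"
proof (cases "N < fib (l + 1)")
  case False
  have "fib (l + 2) \<le> fib (l + 3)" by (rule fib_mono) simp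
  then show ?thesis using assms False unfolding cell_def by (auto simp: eval_nat_numeral)
next
  case True
  let ?y = "x - of_int m - real N * golden"
  have y: "?y \<in> tail_ivl l" and N: "N < fib (l + 2)" using assms True by (auto simp: cell_def)
  have "fib (l + 2) \<le> fib (l + 3)" by (rule fib_mono) simp
  have f3: "fib (l + 3) = fib (l + 2) + fib (l + 1)" by (simp add: eval_nat_numeral)
  \<comment> \<open>\<open>m\<close> drops by \<open>fib (l + 3)\<close> because
    \<open>fib (l + 2) * golden\<close> is that integer minus
    \<open>(- psi) ^ (l + 2)\<close>.\<close>
  have eq: "x - of_int (m - int (fib (l + 3))) - real (N + fib (l + 2)) * golden = ?y + (- psi) ^ (l + 2)"
    using fib_golden[of "l + 2"] by (simp add: algebra_simps eval_nat_numeral)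
  from y tail_ivl_split[of ?y l] consider "?y \<in> tail_ivl (Suc l)" | "?y + (- psi) ^ (l + 2) \<in> tail_ivl (l + 2)"
    by blast
  then show ?thesis
  proof cases
    case 1
    then have "cell (Suc l) N m x" using N \<open>fib (l + 2) \<le> fib (l + 3)\<close>
      by (simp add: cell_def eval_nat_numeral)
    then show ?thesis ..
  next
    case 2
    then have "cell (Suc l) (N + fib (l + 2)) (m - int (fib (l + 3))) x"
      unfolding cell_def eq using True f3 by (auto simp: eval_nat_numeral)
    then show ?thesis using True by blast
  qed
qed

lemma cell_SucD:
  assumes "cell (Suc l) N m x"
  shows "(N < fib (l + 2) \<and> cell l N m x) \<or>
    (\<exists>N0 < fib (l + 1). N = N0 + fib (l + 2) \<and> cell l N0 (m + int (fib (l + 3))) x)"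
proof (cases "N < fib (l + 2)")
  case True
  let ?y = "x - of_int m - real N * golden"
  have "?y \<in> tail_ivl (Suc l)" using assms True by (simp add: cell_def)
  then have "cell l N m x" using True tail_ivl_split[of ?y l] by (simp add: cell_def)
  then show ?thesis using True by blast
next
  case False
  define N0 where "N0 = N - fib (l + 2)"
  have N: "N = N0 + fib (l + 2)" using False by (simp add: N0_def)
  have lt: "N < fib (l + 3)" using assms by (simp add: cell_def eval_nat_numeral)
  have f3: "fib (l + 3) = fib (l + 2) + fib (l + 1)" by (simp add: eval_nat_numeral)
  have N0: "N0 < fib (l + 1)" using N lt f3 by linarith
  let ?y = "x - of_int (m + int (fib (l + 3))) - real N0 * golden"
  have eq: "x - of_int m - real N * golden = ?y + (- psi) ^ (l + 2)"
    using fib_golden[of "l + 2"] by (simp add: N algebra_simps eval_nat_numeral)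
  have "?y + (- psi) ^ (l + 2) \<in> tail_ivl (l + 2)"
    using assms False unfolding cell_def eq by simp
  then have "?y \<in> tail_ivl l" using tail_ivl_split[of ?y l] by blast
  then have "cell l N0 (m + int (fib (l + 3))) x" using N0 fib_mono[of "l+1" "l+2"] by (simp add: cell_def)
  then show ?thesis using N N0 by blast
qed

lemma cell_cover: "\<exists>N m. cell l N m x"
proof (induction l)
  case 0
  define m where "m = \<lfloor>x + psi\<rfloor>"
  have "of_int m \<le> x + psi" "x + psi < of_int m + 1" by (auto simp: m_def)
  \<comment> \<open>\<open>tail_ivl 0\<close> is \<open>{- psi..<1 - psi}\<close>, a fundamental
    domain modulo 1, and 0 is the only natural number below \<open>fib 2\<close>.\<close>
  then have "cell 0 0 m x" using psi_sq
    by (simp add: cell_def tail_ivl_def algebra_simps power2_eq_square)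
  then show ?case by blast
next
  case (Suc l)
  then show ?case using cell_Suc by blast
qed

text \<open>Two cells of level \<open>Suc l\<close> containing \<open>x\<close> have the same parent
  by induction; if they are its two different children, \<open>tail_ivl_disjoint\<close> separates
  them.\<close>

lemma cell_unique:
  assumes "cell l N m x" "cell l N' m' x"
  shows "N = N' \<and> m = m'"
  using assms
proof (induction l arbitrary: N m N' m')
  case 0
  then have "N = 0" "N' = 0" by (auto simp: cell_def)
  then have "x - of_int m \<in> {- psi..<1 - psi}" "x - of_int m' \<in> {- psi..<1 - psi}"
    using 0 psi_sq by (auto simp: cell_def tail_ivl_def numeral_2_eq_2)
  then have "real_of_int (m - m') < 1" "real_of_int (m' - m) < 1" by auto
  then have "m = m'" by linarith
  then show ?case using \<open>N = 0\<close> \<open>N' = 0\<close> by simp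
next
  case (Suc l)
  have mixed: False if "N < fib (l + 2)" "cell (Suc l) N m x" "cell l N m x"
      "N' = N0 + fib (l + 2)" "cell (Suc l) N' m' x" "cell l N0 (m' + int (fib (l + 3))) x"
    for N m N0 N' m'
  proof -
    have e: "N = N0" "m = m' + int (fib (l + 3))" using Suc.IH[OF that(3,6)] by auto
    let ?y = "x - of_int m - real N * golden"
    have "?y \<in> tail_ivl (Suc l)" using that(1,2) by (simp add: cell_def)
    moreover have eq: "x - of_int m' - real N' * golden = ?y + (- psi) ^ (l + 2)"
      using fib_golden[of "l + 2"] that(4) e by (simp add: algebra_simps eval_nat_numeral)
    have "?y + (- psi) ^ (l + 2) \<in> tail_ivl (l + 2)"
      using that(4,5) unfolding cell_def eq by simp
    ultimately show False using tail_ivl_disjoint by blast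
  qed
  from cell_SucD[OF Suc.prems(1)] cell_SucD[OF Suc.prems(2)] show ?case
  proof (elim disjE conjE exE)
    assume "N < fib (l + 2)" "cell l N m x" "N' < fib (l + 2)" "cell l N' m' x"
    then show ?thesis using Suc.IH by blast
  next
    fix N0 assume "N < fib (l + 2)" "cell l N m x" "N' = N0 + fib (l + 2)"
      "cell l N0 (m' + int (fib (l + 3))) x"
    then show ?thesis using mixed Suc.prems by blast
  next
    fix N0 assume "N' < fib (l + 2)" "cell l N' m' x" "N = N0 + fib (l + 2)"
      "cell l N0 (m + int (fib (l + 3))) x"
    then show ?thesis using mixed Suc.prems by blast
  next
    fix N0 N1 assume "N = N0 + fib (l + 2)" "cell l N0 (m + int (fib (l + 3))) x"
      "N' = N1 + fib (l + 2)" "cell l N1 (m' + int (fib (l + 3))) x"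
    then show ?thesis using Suc.IH by fastforce
  qed
qed

lemma cell_bound: "cell l N m x \<Longrightarrow> \<bar>x - of_int m - real N * golden\<bar> \<le> psi ^ (l + 1)"
  using tail_ivl_bound[of "x - of_int m - real N * golden" l]
    tail_ivl_bound[of "x - of_int m - real N * golden" "l + 1"] psi_Suc_less[of "l + 1"]
  by (auto simp: cell_def simp del: power_Suc split: if_splits)

lemma cell_golden: "N < fib (l + 2) \<Longrightarrow> cell l N m (of_int m + real N * golden)"
  using zero_in_tail_ivl by (simp add: cell_def)

section \<open>Digits of the points of a cell\<close>

lemma cell_digit_coarse:
  assumes "cell (l + d) n m' x" "cell l N m x" "i \<le> l + 1"
  shows "zeck_digit i n = zeck_digit i N"
  using assms(1)
proof (induction d arbitrary: n m')
  case 0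
  then show ?case using cell_unique assms(2) by fastforce
next
  case (Suc d)
  then have "cell (Suc (l + d)) n m' x" by simp
  from cell_SucD[OF this] show ?case
  proof (elim disjE conjE exE)
    assume "cell (l + d) n m' x"
    then show ?thesis by (rule Suc.IH)
  next
    fix N0 assume N0: "N0 < fib (l + d + 1)" "n = N0 + fib (l + d + 2)"
      "cell (l + d) N0 (m' + int (fib (l + d + 3))) x"
    have "zeck_digit i n = zeck_digit i N0"
      using zeck_digit_add_fib[OF N0(1), of i] N0(2) assms(3) by simp
    then show ?thesis using Suc.IH[OF N0(3)] by simp
  qed
qed

text \<open>At a fine enough level the integer \<open>n\<close> labels the cell of its own multiple
  of \<open>golden\<close>. Refinement never alters the digits already fixed, so the coarser label
  agrees with \<open>n\<close> there.\<close>

lemma cell_digit_nat: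
  assumes "cell l N m (of_int j + real n * golden)" "i \<le> l + 1"
  shows "zeck_digit i n = zeck_digit i N"
proof -
  have "fib (n + 2) \<le> fib (l + n + 2)" by (rule fib_mono) simp
  then have "cell (l + n) n j (of_int j + real n * golden)"
    using less_fib[of n] by (intro cell_golden) linarith
  from cell_digit_coarse[OF this assms] show ?thesis .
qed

text \<open>Uniqueness of cells replaces the irrationality of \<open>golden\<close>: at a common
  fine level both \<open>n\<close> and \<open>n'\<close> label the cell of the same point. This
  makes the \<open>THE\<close> in \<open>digit_tilde\<close> well defined.\<close>

lemma golden_frac_inj:
  assumes "frac (real n * golden) = frac (real n' * golden)"
  shows "n = n'"
proof -
  define L where "L = n + n'"
  define x where "x = frac (real n * golden)"
  have "fib (n + 2) \<le> fib (L + 2)" "fib (n' + 2) \<le> fib (L + 2)"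
    by (rule fib_mono, simp add: L_def)+
  then have "n < fib (L + 2)" "n' < fib (L + 2)" using less_fib[of n] less_fib[of n'] by auto
  then have "cell L n (- \<lfloor>real n * golden\<rfloor>) x" "cell L n' (- \<lfloor>real n' * golden\<rfloor>) x"
    using cell_golden[of n L "- \<lfloor>real n * golden\<rfloor>"] cell_golden[of n' L "- \<lfloor>real n' * golden\<rfloor>"] assms
    by (simp_all add: x_def frac_def)
  then show ?thesis using cell_unique by blast
qed

lemma ex_psi_power_less: "\<epsilon> > 0 \<Longrightarrow> \<exists>l. psi ^ l < \<epsilon>"
  using psi_bounds real_arch_pow_inv by blast

lemma golden_points_dense:
  assumes "0 \<le> a" "a < b" "b \<le> 1"
  shows "\<exists>n. a < frac (real n * golden) \<and> frac (real n * golden) < b"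
proof -
  define q where "q = (a + b) / 2"
  obtain l where l: "psi ^ l < (b - a) / 2" using ex_psi_power_less[of "(b - a) / 2"] assms by auto
  \<comment> \<open>The base point \<open>of_int m + real N * golden\<close> of a fine cell around
    the midpoint approximates it, and \<open>N\<close> is a natural number by construction.\<close>
  obtain N m where "cell l N m q" using cell_cover by blast
  then have "\<bar>q - of_int m - real N * golden\<bar> < (b - a) / 2"
    using cell_bound[of l N m q] l psi_Suc_less[of l] by (simp del: power_Suc)
  then have "a < of_int m + real N * golden" "of_int m + real N * golden < b"
    unfolding q_def abs_less_iff by (simp_all add: field_simps)
  moreover from this have "frac (real N * golden) = of_int m + real N * golden"
    using assms by (intro frac_unique_iff[THEN iffD2]) auto
  ultimately show ?thesis by metis
qed

text \<open>Cells are closed on the left, which matches the limit from the right in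
  \<open>digit_prime\<close>.\<close>

lemma cell_right_open:
  assumes "cell l N m x"
  obtains \<epsilon> where "\<epsilon> > 0" "\<And>z. x \<le> z \<Longrightarrow> z < x + \<epsilon> \<Longrightarrow> cell l N m z"
proof -
  define S where "S = tail_ivl (if N < fib (l + 1) then l else l + 1)"
  obtain lo hi where S: "S = {lo..<hi}" unfolding S_def tail_ivl_def by (cases "N < fib (l + 1)"; cases "even l"; auto)
  define y where "y = x - of_int m - real N * golden"
  have y: "lo \<le> y" "y < hi" using assms unfolding cell_def S_def[symmetric] S y_def by auto
  show thesis
  proof (rule that[of "hi - y"])
    show "hi - y > 0" using y by simp
    fix z assume "x \<le> z" "z < x + (hi - y)"
    then show "cell l N m z" using assms y unfolding cell_def S_def[symmetric] S y_def by auto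
  qed
qed

lemma cell_add_int: "cell l N m (x + of_int j) \<longleftrightarrow> cell l N (m - j) x"
  by (simp add: cell_def algebra_simps)

text \<open>All \<open>golden_points\<close> slightly to the right of the point lie in the same
  cell, so \<open>digit_tilde i\<close> is eventually constant along the filter.\<close>

lemma digit_prime_cell:
  assumes "cell l N m x" "i \<le> l + 1"
  shows "digit_prime i x = real (zeck_digit i N)"
proof -
  define y where "y = frac x"
  have y: "0 \<le> y" "y < 1" by (auto simp: y_def frac_lt_1)
  have x: "x = y + of_int \<lfloor>x\<rfloor>" by (simp add: y_def frac_def)
  obtain M where "cell l N M y" using assms(1) cell_add_int x by metis
  then obtain \<epsilon> where \<epsilon>: "\<epsilon> > 0" "\<And>z. y \<le> z \<Longrightarrow> z < y + \<epsilon> \<Longrightarrow> cell l N M z"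
    using cell_right_open by blast
  let ?F = "at y within (golden_points \<inter> {y<..})"
  have val: "digit_tilde i z = real (zeck_digit i N)"
    if z: "z \<in> golden_points" "y \<le> z" "z < y + \<epsilon>" for z
  proof -
    obtain n where n: "z = frac (real n * golden)" using z(1) by (auto simp: golden_points_def)
    have "(THE n. z = frac (real n * golden)) = n"
      using golden_frac_inj n by (intro the_equality) metis+
    moreover have "z = of_int (- \<lfloor>real n * golden\<rfloor>) + real n * golden"
      by (simp add: n frac_def)
    then have "zeck_digit i n = zeck_digit i N"
      using cell_digit_nat[OF _ assms(2)] \<epsilon>(2)[OF z(2,3)] by metis
    ultimately show ?thesis by (simp add: digit_tilde_def)
  qed
  have "\<forall>\<^sub>F z in ?F. digit_tilde i z = real (zeck_digit i N)"
    unfolding eventually_at using \<epsilon>(1)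
    by (intro exI[of _ \<epsilon>]) (auto intro!: val simp: dist_real_def)
  then have lim: "(digit_tilde i \<longlongrightarrow> real (zeck_digit i N)) ?F"
    using tendsto_eventually by blast
  \<comment> \<open>Density makes the filter nontrivial; only then does convergence determine
    \<open>Lim\<close>.\<close>
  have "y islimpt (golden_points \<inter> {y<..})"
    unfolding islimpt_approachable
  proof (intro allI impI)
    fix e :: real assume "e > 0"
    then obtain n where "y < frac (real n * golden)" "frac (real n * golden) < min 1 (y + e)"
      using golden_points_dense[of y "min 1 (y + e)"] y by auto
    then show "\<exists>x'\<in>golden_points \<inter> {y<..}. x' \<noteq> y \<and> dist x' y < e"
      by (intro bexI[of _ "frac (real n * golden)"]) (auto simp: golden_points_def dist_real_def)
  qed
  then have "?F \<noteq> bot" by (simp add: trivial_limit_within)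
  from tendsto_Lim[OF this lim] show ?thesis by (simp add: digit_prime_def y_def)
qed

lemma g_cell:
  assumes "cell l N m x"
  shows "g (l + 1) x = real (zeck_sum N)"
proof -
  have "g (l + 1) x = (\<Sum>i = 2..l + 1. real (zeck_digit i N))"
    unfolding g_def by (intro sum.cong refl digit_prime_cell[OF assms]) auto
  also have "\<dots> = real (zeck_sum N)"
    using zeck_sum_eq[of N "l + 1"] assms by (simp add: cell_def flip: of_nat_sum)
  finally show ?thesis .
qed

lemma g_add_int: "g L (x + of_int j) = g L x"
  by (simp add: g_def digit_prime_def frac_def)

section \<open>Increments of the digit sum\<close>

text \<open>The remainder \<open>x - of_int m - real A * golden\<close> is unchanged, and labels of
  the same type test it against the same tail interval.\<close>

lemma cell_transport:
  assumes "cell l A m x" "A' < fib (l + 2)" "A < fib (l + 1) \<longleftrightarrow> A' < fib (l + 1)"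
  shows "cell l A' m (x + (real A' - real A) * golden)"
proof -
  have eq: "x + (real A' - real A) * golden - of_int m - real A' * golden = x - of_int m - real A * golden"
    by (simp add: algebra_simps)
  show ?thesis using assms unfolding cell_def eq by auto
qed

text \<open>Two cells of the same type are refined in the same way, so all digits beyond the
  level of the cells agree at corresponding points.\<close>

lemma g_diff_cell:
  assumes "cell l N m x" "N' < fib (l + 2)" "N < fib (l + 1) \<longleftrightarrow> N' < fib (l + 1)" "l + 1 \<le> L"
  shows "g L (x + (real N' - real N) * golden) - g L x = real (zeck_sum N') - real (zeck_sum N)"
proof -
  define x' where "x' = x + (real N' - real N) * golden"
  \<comment> \<open>Written with sums of naturals: the difference of the labels and that of their
    digit sums persist, because each refinement adds the same digit to both.\<close>
  have ex: "\<exists>A A' m. cell (l + d) A m x \<and> cell (l + d) A' m x' \<and> A + N' = A' + N \<and>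
      zeck_sum A + zeck_sum N' = zeck_sum A' + zeck_sum N \<and>
      (A < fib (l + d + 1) \<longleftrightarrow> A' < fib (l + d + 1))" for d
  proof (induction d)
    case 0
    have "cell l N' m x'" unfolding x'_def using assms by (intro cell_transport) auto
    then show ?case using assms by (intro exI[of _ N] exI[of _ N'] exI[of _ m]) auto
  next
    case (Suc d)
    let ?l = "l + d"
    from Suc obtain A A' m where A: "cell ?l A m x" "cell ?l A' m x'" "A + N' = A' + N"
      "zeck_sum A + zeck_sum N' = zeck_sum A' + zeck_sum N"
      "A < fib (?l + 1) \<longleftrightarrow> A' < fib (?l + 1)" by blast
    have lt: "A < fib (?l + 2)" "A' < fib (?l + 2)" using A by (auto simp: cell_def)
    have f3: "fib (?l + 3) = fib (?l + 2) + fib (?l + 1)" by (simp add: eval_nat_numeral)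
    have x': "x' = x + (real B' - real B) * golden" if "B + N' = B' + N" for B B'
    proof -
      have "real B + real N' = real B' + real N" using that by (metis of_nat_add)
      then show ?thesis by (simp add: x'_def)
    qed
    from cell_Suc[OF A(1)] show ?case
    proof (elim disjE conjE)
      assume c: "cell (Suc ?l) A m x"
      have "cell (Suc ?l) A' m x'" unfolding x'[OF A(3)]
        using c lt f3 by (intro cell_transport) (auto simp: eval_nat_numeral)
      then show ?thesis using c lt A by (intro exI[of _ A] exI[of _ A'] exI[of _ m]) auto
    next
      let ?B = "A + fib (?l + 2)" and ?B' = "A' + fib (?l + 2)"
      let ?m = "m - int (fib (?l + 3))"
      assume small: "A < fib (?l + 1)" and c: "cell (Suc ?l) ?B ?m x"
      have small': "A' < fib (?l + 1)" using small A(5) by simp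
      have e: "?B + N' = ?B' + N" using A(3) by simp
      have "cell (Suc ?l) ?B' ?m x'" unfolding x'[OF e]
        using c f3 small small' by (intro cell_transport) (auto simp: eval_nat_numeral)
      moreover have "zeck_sum ?B + zeck_sum N' = zeck_sum ?B' + zeck_sum N"
        using zeck_sum_add_fib[OF small] zeck_sum_add_fib[OF small'] A(4) by simp
      ultimately show ?thesis using c e
        by (intro exI[of _ ?B] exI[of _ ?B'] exI[of _ ?m]) simp
    qed
  qed
  obtain d where L: "L = l + d + 1" using assms(4) by (metis add.assoc add.commute le_Suc_ex)
  from ex[of d] obtain A A' m where A: "cell (l + d) A m x" "cell (l + d) A' m x'"
      "zeck_sum A + zeck_sum N' = zeck_sum A' + zeck_sum N" by blast
  have "real (zeck_sum A) + real (zeck_sum N') = real (zeck_sum A') + real (zeck_sum N)"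
    using A(3) by (metis of_nat_add)
  then show ?thesis using g_cell[OF A(1)] g_cell[OF A(2)] by (simp add: L x'_def)
qed

lemma g_add_fib_golden:
  assumes "odd k"
  shows "g L (x + real (fib k) * golden) = g L (x + psi ^ k)"
proof -
  have "x + real (fib k) * golden = (x + psi ^ k) + of_int (int (fib (Suc k)))"
    using assms by (simp add: fib_golden)
  then show ?thesis by (simp only: g_add_int)
qed

lemma tail_ivl_ends:
  obtains lo hi where "tail_ivl k = {lo..<hi}" "hi - lo = psi ^ k"
    "\<bar>lo\<bar> \<le> psi ^ k" "\<bar>hi\<bar> \<le> psi ^ k"
proof (rule that)
  have pos: "0 < psi ^ (k + 1)" "0 < psi ^ (k + 2)" "psi ^ (k + 2) = psi ^ k - psi ^ (k + 1)"
    using psi_Suc_Suc[of k] psi_bounds by simp_all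
  have arith: "(if e then b else a) - (if e then - a else - b) = c \<and>
      \<bar>if e then - a else - b\<bar> \<le> c \<and> \<bar>if e then b else a\<bar> \<le> c"
    if "0 < a" "0 < b" "b = c - a" for a b c :: real and e
    using that by auto
  let ?lo = "if even k then - (psi ^ (k + 1)) else - (psi ^ (k + 2))"
  let ?hi = "if even k then psi ^ (k + 2) else psi ^ (k + 1)"
  show "tail_ivl k = {?lo..<?hi}" by (simp add: tail_ivl_def)
  show "?hi - ?lo = psi ^ k" "\<bar>?lo\<bar> \<le> psi ^ k" "\<bar>?hi\<bar> \<le> psi ^ k"
    using arith[OF pos] by (blast dest: conjunct1 conjunct2)+
qed

text \<open>Take the cell of level \<open>l + 2\<close> labelled by some
  \<open>N < fib (l + 2)\<close>. Since \<open>N + fib k < fib (l + 3)\<close>, both labels have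
  last digit 0 at that level, and \<open>g_diff_cell\<close> gives a constant increment on the whole
  cell.\<close>

lemma ex_constant_diff_interval:
  assumes "odd k" "k \<le> l + 1" "4 * psi ^ (l + 1) \<le> b - a"
  shows "\<exists>a' b' v::int. a \<le> a' \<and> b' \<le> b \<and> b' - a' = psi ^ (l + 2) \<and>
    (\<forall>p\<in>{a'..<b'}. \<forall>L\<ge>l + 3. g L (p + psi ^ k) = g L p + of_int v)"
proof -
  define y where "y = (a + b) / 2"
  obtain N m where c: "cell l N m y" using cell_cover by blast
  define q where "q = of_int m + real N * golden"
  have q: "\<bar>y - q\<bar> \<le> psi ^ (l + 1)" using cell_bound[OF c] by (simp add: q_def)
  have N: "N < fib (l + 2)" using c by (simp add: cell_def)
  have "fib k \<le> fib (l + 1)" using assms(2) by (rule fib_mono)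
  then have N': "N + fib k < fib (l + 3)" using N by (simp add: eval_nat_numeral)
  have f4: "fib (l + 3) \<le> fib (l + 4)" by (rule fib_mono) simp
  obtain lo hi where T: "tail_ivl (l + 2) = {lo..<hi}" "hi - lo = psi ^ (l + 2)"
    "\<bar>lo\<bar> \<le> psi ^ (l + 2)" "\<bar>hi\<bar> \<le> psi ^ (l + 2)" by (rule tail_ivl_ends)
  have le: "psi ^ (l + 2) \<le> psi ^ (l + 1)" using psi_Suc_less[of "l + 1"] by simp
  \<comment> \<open>Half of \<open>b - a\<close> is at least \<open>2 * psi ^ (l + 1)\<close>: one
    part covers the distance from \<open>y\<close> to \<open>q\<close>, the other the extent of the
    cell around \<open>q\<close>.\<close>
  have "y - a = (b - a) / 2" "b - y = (b - a) / 2" by (simp_all add: y_def field_simps)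
  then have "a \<le> q + lo" "q + hi \<le> b"
    using q T(3,4) le assms(3) unfolding abs_le_iff by linarith+
  moreover have "(q + hi) - (q + lo) = psi ^ (l + 2)" using T(2) by simp
  moreover have "g L (p + psi ^ k) = g L p + of_int (int (zeck_sum (N + fib k)) - int (zeck_sum N))"
    if p: "p \<in> {q + lo..<q + hi}" and L: "l + 3 \<le> L" for p L
  proof -
    have "p - of_int m - real N * golden \<in> tail_ivl (l + 2)" unfolding T(1) using p by (auto simp: q_def)
    then have "cell (l + 2) N m p" using N N' f4 by (simp add: cell_def eval_nat_numeral)
    from g_diff_cell[OF this, of "N + fib k" L] show ?thesis
      using N' f4 L g_add_fib_golden[OF assms(1), of L p] by (simp add: eval_nat_numeral)
  qed
  ultimately show ?thesis by blast
qed

text \<open>Near the point separating the cells of \<open>N\<close> and of \<open>N + F\<^sub>k\<^sub>+\<^sub>1\<close>, adding \<open>F\<^sub>k\<close> creates a new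
  digit on one side, but merges with the digit \<open>F\<^sub>k\<^sub>+\<^sub>1\<close> into \<open>F\<^sub>k\<^sub>+\<^sub>2\<close> on the other side.\<close>

lemma ex_jump_point:
  assumes "odd k" "3 \<le> k"
  shows "\<exists>z. \<bar>z - y\<bar> \<le> 2 * psi ^ (k - 2) \<and> (\<forall>L\<ge>k + 3.
    (\<forall>p\<in>{z - psi ^ (k + 2)..<z}. g L (p + psi ^ k) = g L p) \<and>
    (\<forall>p\<in>{z..<z + psi ^ k}. g L (p + psi ^ k) = g L p + 1))"
proof -
  \<comment> \<open>This level gives \<open>N < fib (k - 1)\<close>, so the positions from
    \<open>k - 1\<close> on are empty and \<open>fib k\<close>, \<open>fib (k + 1)\<close> or
    \<open>fib (k + 2)\<close> can be added as a single digit.\<close>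
  define l where "l = k - 3"
  have k: "k = l + 3" using assms(2) by (simp add: l_def)
  obtain N m where c: "cell l N m y" using cell_cover by blast
  define q where "q = of_int m + real N * golden"
  have q: "\<bar>y - q\<bar> \<le> psi ^ (k - 2)" using cell_bound[OF c] by (simp add: q_def k)
  have N: "N < fib (k - 1)" using c by (simp add: cell_def k)
  \<comment> \<open>For odd \<open>k\<close> the left end of \<open>tail_ivl k\<close> is
    \<open>- (psi ^ (k + 2))\<close>, so \<open>z\<close> is the left end of the cell labelled
    \<open>N\<close> at level \<open>k\<close>.\<close>
  define z where "z = q - psi ^ (k + 2)"
  have rec: "psi ^ k = psi ^ (k + 1) + psi ^ (k + 2)" using psi_Suc_Suc[of k] by simp
  have "psi ^ (k + 2) \<le> psi ^ (k - 2)" using psi_bounds by (intro power_decreasing) auto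
  then have "\<bar>z - y\<bar> \<le> 2 * psi ^ (k - 2)" using q psi_power_pos[of "k + 2"]
    unfolding z_def abs_le_iff by linarith
  have fk: "fib (k + 1) = fib k + fib (k - 1)" using assms by (cases k) auto
  have f2: "fib (k + 2) = fib (k + 1) + fib k" and f3: "fib (k + 3) = fib (k + 2) + fib (k + 1)"
    and f4: "fib (k + 4) = fib (k + 3) + fib (k + 2)" by (simp_all add: eval_nat_numeral)
  have fpos: "fib k > 0" using assms by (intro fib_neq_0_nat) simp
  have left: "g L (p + psi ^ k) = g L p"
    if p: "p \<in> {z - psi ^ (k + 2)..<z}" and L: "k + 3 \<le> L" for p L
  proof -
    \<comment> \<open>At level \<open>k + 2\<close> both labels stay below
      \<open>fib (k + 3)\<close>, so their cells have the same type.\<close>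
    let ?A = "N + fib (k + 1)" and ?A' = "N + fib (k + 2)" and ?m = "m - int (fib (k + 2))"
    have eq: "p - of_int ?m - real ?A * golden = (p - q) + psi ^ (k + 1)"
      using fib_golden[of "k + 1"] assms(1) by (simp add: q_def algebra_simps)
    have "(p - q) + psi ^ (k + 1) \<in> tail_ivl (k + 2)"
      unfolding tail_ivl_refine(3) using p assms(1) by (simp add: z_def)
    moreover have "?A < fib (k + 2 + 1)" "?A < fib (k + 2 + 2)"
      using N fk f2 f3 f4 by (simp_all add: eval_nat_numeral)
    ultimately have "cell (k + 2) ?A ?m p" unfolding cell_def eq by simp
    from g_diff_cell[OF this, of ?A' L]
    have "g L (p + real (fib k) * golden) - g L p = real (zeck_sum ?A') - real (zeck_sum ?A)"
      using N fk f2 f3 f4 L by (simp add: eval_nat_numeral)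
    moreover have "zeck_sum ?A' = Suc (zeck_sum N)"
      using zeck_sum_add_fib[of N "k + 1"] N fk by simp
    moreover have "zeck_sum ?A = Suc (zeck_sum N)"
      using zeck_sum_add_fib[of N k] N fib_mono[of "k - 1" k] assms(2) by simp
    ultimately show ?thesis using g_add_fib_golden[OF assms(1), of L p] by simp
  qed
  have right: "g L (p + psi ^ k) = g L p + 1"
    if p: "p \<in> {z..<z + psi ^ k}" and L: "k + 3 \<le> L" for p L
  proof -
    have "- (psi ^ (k + 2)) \<le> p - q" "p - q < psi ^ (k + 1)"
      using p rec unfolding z_def atLeastLessThan_iff by linarith+
    then have "p - of_int m - real N * golden \<in> tail_ivl k"
      unfolding tail_ivl_refine(1) using assms(1) by (simp add: q_def algebra_simps)
    then have "cell k N m p" using N fk f2 by (simp add: cell_def del: fib.simps)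
    from g_diff_cell[OF this, of "N + fib k" L]
    have "g L (p + real (fib k) * golden) - g L p = real (zeck_sum (N + fib k)) - real (zeck_sum N)"
      using N fk f2 L by simp
    moreover have "zeck_sum (N + fib (k - 1 + 1)) = Suc (zeck_sum N)"
      using N assms(2) by (intro zeck_sum_add_fib) auto
    then have "zeck_sum (N + fib k) = Suc (zeck_sum N)" using assms(2) by simp
    ultimately show ?thesis using g_add_fib_golden[OF assms(1), of L p] by simp
  qed
  show ?thesis
    using \<open>\<bar>z - y\<bar> \<le> 2 * psi ^ (k - 2)\<close> left right by blast
qed

text \<open>For positive \<open>L\<close> this is a finite combination of indicators of sets
  \<open>C N\<close>, each a countable union of half-open intervals.\<close>

lemma borel_measurable_g [measurable]: "g L \<in> borel_measurable borel"
proof (cases L)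
  case 0
  then have "g L = (\<lambda>x. 0)" by (simp add: g_def fun_eq_iff)
  then show ?thesis by simp
next
  case (Suc l)
  define C where "C N = (\<Union>m. {x. cell l N m x})" for N
  have C: "C N \<in> sets borel" for N
  proof -
    have "{x. cell l N m x} \<in> sets borel" for m
    proof -
      obtain lo hi where T: "tail_ivl (if N < fib (l + 1) then l else l + 1) = {lo..<hi}"
        using tail_ivl_ends by blast
      have "{x. cell l N m x} = (if N < fib (l + 2)
          then {lo + of_int m + real N * golden..<hi + of_int m + real N * golden} else {})"
        unfolding cell_def T by auto
      then show ?thesis by simp
    qed
    then show ?thesis unfolding C_def by blast
  qed
  have "g L x = (\<Sum>N<fib (l + 2). real (zeck_sum N) * indicator (C N) x)" for x
  proof -
    obtain N m where c: "cell l N m x" using cell_cover by blast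
    have "x \<in> C N' \<longleftrightarrow> N' = N" for N' unfolding C_def using c cell_unique by blast
    then have "real (zeck_sum N') * indicator (C N') x = (if N' = N then real (zeck_sum N) else 0)" for N'
      by (auto simp: indicator_def)
    moreover have "N \<in> {..<fib (l + 2)}" using c by (simp add: cell_def)
    ultimately show ?thesis using g_cell[OF c] Suc by simp
  qed
  then have "g L = (\<lambda>x. \<Sum>N<fib (l + 2). real (zeck_sum N) * indicator (C N) x)" by blast
  also have "\<dots> \<in> borel_measurable borel" 
    by (intro borel_measurable_sum borel_measurable_times borel_measurable_const
        borel_measurable_indicator C)
  finally show ?thesis .
qed

section \<open>Boxes with constant increments\<close>

lemma dist_nearest_int_le: "dist_nearest_int x \<le> \<bar>x - of_int n\<bar>"
  unfolding dist_nearest_int_def using round_diff_minimal[of x n] by (simp add: abs_minus_commute)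

lemma dist_nearest_int_nonneg: "0 \<le> dist_nearest_int x"
  by (simp add: dist_nearest_int_def)

lemma dist_nearest_int_le_half: "dist_nearest_int x \<le> 1/2"
  unfolding dist_nearest_int_def using of_int_round_abs_le[of x] by (simp add: abs_minus_commute)

lemma dist_nearest_int_diff: "dist_nearest_int (x - y) \<le> dist_nearest_int x + dist_nearest_int y"
proof -
  have "dist_nearest_int (x - y) \<le> \<bar>(x - y) - of_int (round x - round y)\<bar>"
    by (rule dist_nearest_int_le)
  then show ?thesis unfolding dist_nearest_int_def of_int_diff by linarith
qed

lemma dist_nearest_int_minus: "dist_nearest_int (- x) = dist_nearest_int x"
proof -
  have "dist_nearest_int (- y) \<le> dist_nearest_int y" for y
    using dist_nearest_int_le[of "- y" "- round y"] by (simp add: dist_nearest_int_def abs_minus_commute)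
  from this[of x] this[of "- x"] show ?thesis by simp
qed

lemma e_add: "e (x + y) = e x * e y"
  by (simp add: e_def exp_add[symmetric] algebra_simps)

lemma e_eq_cis: "e x = cis (2 * pi * x)"
  by (simp add: e_def cis_conv_exp algebra_simps)

lemma norm_e [simp]: "cmod (e x) = 1"
  by (simp add: e_eq_cis)

lemma e_of_int [simp]: "e (of_int n) = 1"
  unfolding e_eq_cis using cis_multiple_2pi[of "of_int n"] by simp

lemma cnj_e: "cnj (e x) = e (- x)"
  by (simp add: e_eq_cis cis_cnj)

lemma e_sum: "finite A \<Longrightarrow> e (sum f A) = (\<Prod>a\<in>A. e (f a))"
  by (induction A rule: finite_induct) (simp_all add: e_add, simp add: e_def)

text \<open>On \<open>[0, pi / 4]\<close> the cosine is at least 1/2, so the mean value theorem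
  gives \<open>sin z \<ge> z / 2\<close>, and \<open>z \<ge> d\<close> because
  \<open>pi \<ge> 2\<close>.\<close>

lemma sin_pi_half_ge:
  assumes "0 \<le> d" "d \<le> 1/2"
  shows "d / 2 \<le> sin (pi * d / 2)"
proof (cases "d = 0")
  case False
  define z where "z = pi * d / 2"
  have z: "0 < z" "z \<le> pi / 4" using assms False by (auto simp: z_def field_simps)
  obtain \<xi> where \<xi>: "0 < \<xi>" "\<xi> < z" "sin z - sin 0 = (z - 0) * cos \<xi>"
    using MVT2[of 0 z sin cos] z(1) by auto
  have "cos (pi / 4) \<le> cos \<xi>" using \<xi> z pi_gt_zero by (intro cos_monotone_0_pi_le) auto
  moreover have "1 / 2 \<le> cos (pi / 4)" unfolding cos_45 by simp
  ultimately have "z * (1 / 2) \<le> z * cos \<xi>" using z by (intro mult_left_mono) auto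
  moreover have "d \<le> z" using mult_right_mono[of 2 pi d] assms pi_gt3 by (simp add: z_def)
  moreover have "sin z = z * cos \<xi>" using \<xi>(3) by simp
  ultimately have "d / 2 \<le> sin z" by linarith
  then show ?thesis by (simp add: z_def)
qed simp

text \<open>With \<open>d\<close> the signed distance to the nearest integer, the modulus is
  \<open>2 * cos (pi * d)\<close>, that is \<open>2 - 4 * (sin (pi * d / 2))^2\<close>, and the sine
  has modulus at least \<open>\<bar>d\<bar> / 2\<close>.\<close>

lemma norm_one_plus_e_le: "cmod (1 + e x) \<le> 2 - (dist_nearest_int x)\<^sup>2"
proof -
  define d where "d = x - of_int (round x)"
  have d: "\<bar>d\<bar> = dist_nearest_int x" by (simp add: d_def dist_nearest_int_def)
  have "e x = e (d + of_int (round x))" by (simp add: d_def)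
  then have ed: "e x = e d" by (simp only: e_add e_of_int mult_1_right)
  have "1 + e d = cis (pi * d) * (cis (- (pi * d)) + cis (pi * d))"
    by (simp add: e_eq_cis distrib_left cis_mult mult.assoc)
  also have "cis (- (pi * d)) + cis (pi * d) = of_real (2 * cos (pi * d))"
    by (simp add: complex_eq_iff)
  finally have n: "cmod (1 + e x) = 2 * \<bar>cos (pi * d)\<bar>" by (simp add: ed norm_mult del: of_real_mult)
  have le: "\<bar>d\<bar> \<le> 1/2" using dist_nearest_int_le_half[of x] d by simp
  have "cos (pi * d) \<ge> 0"
  proof (rule cos_ge_zero)
    have "\<bar>pi * d\<bar> \<le> pi / 2" using mult_left_mono[OF le, of pi] by (simp add: abs_mult)
    then show "- (pi / 2) \<le> pi * d" "pi * d \<le> pi / 2" by linarith+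
  qed
  moreover have "cos (pi * d) = cos (pi * \<bar>d\<bar>)" by (cases "d \<ge> 0") simp_all
  moreover have "cos (pi * \<bar>d\<bar>) = 1 - 2 * (sin (pi * \<bar>d\<bar> / 2))\<^sup>2"
    using cos_double_sin[of "pi * \<bar>d\<bar> / 2"] by simp
  moreover have "(\<bar>d\<bar> / 2)\<^sup>2 \<le> (sin (pi * \<bar>d\<bar> / 2))\<^sup>2"
    using sin_pi_half_ge[of "\<bar>d\<bar>"] le by (intro power_mono) auto
  moreover have "(\<bar>d\<bar> / 2)\<^sup>2 = (dist_nearest_int x)\<^sup>2 / 4" by (simp add: d power_divide)
  ultimately show ?thesis unfolding n by linarith
qed

text \<open>The numbers \<open>\<theta> * v\<close> and \<open>\<theta> * (v + \<sigma>)\<close>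
  differ by \<open>\<theta>\<close> up to sign, so they cannot both be closer to the integers than
  half the distance of \<open>\<theta>\<close>. The parameter \<open>s\<close> will choose the side
  of the jump.\<close>

lemma norm_one_plus_e_alternative:
  assumes "\<bar>\<sigma>\<bar> = (1::int)"
  shows "\<exists>s\<in>{0, 1}. cmod (1 + e (\<theta> * (v + of_int \<sigma> * s))) \<le> 2 - (dist_nearest_int \<theta>)\<^sup>2 / 4"
proof -
  have "dist_nearest_int \<theta> = dist_nearest_int (\<theta> * (v + of_int \<sigma>) - \<theta> * v)"
    using assms dist_nearest_int_minus[of \<theta>] by (auto simp: algebra_simps abs_if split: if_splits)
  also have "\<dots> \<le> dist_nearest_int (\<theta> * (v + of_int \<sigma>)) + dist_nearest_int (\<theta> * v)"
    by (rule dist_nearest_int_diff)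
  finally have "\<exists>s\<in>{0,1}. dist_nearest_int \<theta> / 2 \<le> dist_nearest_int (\<theta> * (v + of_int \<sigma> * s))"
    by (cases "dist_nearest_int \<theta> / 2 \<le> dist_nearest_int (\<theta> * v)") auto
  then obtain s where s: "s \<in> {0,1}" "dist_nearest_int \<theta> / 2 \<le> dist_nearest_int (\<theta> * (v + of_int \<sigma> * s))"
    by blast
  have "(dist_nearest_int \<theta> / 2)\<^sup>2 \<le> (dist_nearest_int (\<theta> * (v + of_int \<sigma> * s)))\<^sup>2"
    using s(2) dist_nearest_int_nonneg by (intro power_mono) auto
  then show ?thesis using norm_one_plus_e_le[of "\<theta> * (v + of_int \<sigma> * s)"] s(1)
    by (intro bexI[of _ s]) (auto simp: power_divide)
qed

text \<open>The box is shrunk once for every \<open>i\<close>, so that all the points \<open>x + c i * u + r i\<close>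
  end up, each in its own interval, where the increment of \<open>g\<close> is constant.\<close>

lemma ex_constant_diff_box:
  fixes c :: "'i \<Rightarrow> real"
  assumes "finite A" "\<forall>i\<in>A. 1 \<le> c i" "0 < d"
  shows "\<exists>d'>0. \<exists>M. \<forall>k r \<xi> u1 u2. odd k \<longrightarrow> d * psi ^ k \<le> u2 - u1 \<longrightarrow>
    (\<exists>u1' u2' (v :: 'i \<Rightarrow> int). u1 \<le> u1' \<and> u2' \<le> u2 \<and> d' * psi ^ k \<le> u2' - u1' \<and>
      (\<forall>i\<in>A. \<forall>u\<in>{u1'..u2'}. \<forall>x\<in>{\<xi> - d' * psi ^ k..\<xi> + d' * psi ^ k}. \<forall>L\<ge>k + M.
        g L (x + c i * u + r i + psi ^ k) = g L (x + c i * u + r i) + of_int (v i)))"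
  using assms(1,2)
proof (induction A rule: finite_induct)
  case empty
  then show ?case using assms(3) by (intro exI[of _ d]) auto
next
  case (insert j A)
  have "\<exists>d'>0. \<exists>M. \<forall>k r \<xi> u1 u2. odd k \<longrightarrow> d * psi ^ k \<le> u2 - u1 \<longrightarrow>
    (\<exists>u1' u2' (v :: 'i \<Rightarrow> int). u1 \<le> u1' \<and> u2' \<le> u2 \<and> d' * psi ^ k \<le> u2' - u1' \<and>
      (\<forall>i\<in>A. \<forall>u\<in>{u1'..u2'}. \<forall>x\<in>{\<xi> - d' * psi ^ k..\<xi> + d' * psi ^ k}. \<forall>L\<ge>k + M.
        g L (x + c i * u + r i + psi ^ k) = g L (x + c i * u + r i) + of_int (v i)))"
    using insert by simp
  then obtain d1 M1 where d1: "d1 > 0" and IH: "\<And>k r \<xi> u1 u2. odd k \<Longrightarrow> d * psi ^ k \<le> u2 - u1 \<Longrightarrow>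
    (\<exists>u1' u2' (v :: 'i \<Rightarrow> int). u1 \<le> u1' \<and> u2' \<le> u2 \<and> d1 * psi ^ k \<le> u2' - u1' \<and>
      (\<forall>i\<in>A. \<forall>u\<in>{u1'..u2'}. \<forall>x\<in>{\<xi> - d1 * psi ^ k..\<xi> + d1 * psi ^ k}. \<forall>L\<ge>k + M1.
        g L (x + c i * u + r i + psi ^ k) = g L (x + c i * u + r i) + of_int (v i)))"
    by metis
  \<comment> \<open>Makes the interval for \<open>u\<close> left by the induction hypothesis at
    least \<open>4 * psi ^ (k + q)\<close> long, as \<open>ex_constant_diff_interval\<close>
    requires.\<close>
  obtain q where q: "psi ^ q < d1 / 4" using ex_psi_power_less[of "d1 / 4"] d1 by auto
  have cj: "1 \<le> c j" using insert.prems by simp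
  define \<delta> where "\<delta> = psi ^ (q + 1) / 4"
  have \<delta>: "\<delta> > 0" by (simp add: \<delta>_def del: power_Suc)
  \<comment> \<open>Division by \<open>c j\<close> accounts for the stretching of \<open>u\<close>
    to \<open>c j * u\<close>.\<close>
  define d2 where "d2 = min d1 (\<delta> / c j)"
  have "\<delta> * 1 \<le> \<delta> * c j" using \<delta> cj by (intro mult_left_mono) auto
  then have "\<delta> / c j \<le> \<delta>" using cj by (simp add: divide_le_eq)
  then have d2: "d2 > 0" "d2 \<le> d1" "d2 \<le> \<delta>" using d1 \<delta> cj by (auto simp: d2_def)
  have "c j * d2 \<le> c j * (\<delta> / c j)" using cj by (intro mult_left_mono) (auto simp: d2_def)
  then have d2c: "c j * d2 \<le> \<delta>" using cj by simp
  show ?case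
  proof (rule exI[of _ d2], rule conjI[OF d2(1)], rule exI[of _ "max M1 (q + 2)"], intro allI impI)
    fix k r \<xi> u1 u2
    assume k: "odd k" and u: "d * psi ^ k \<le> u2 - u1"
    have pk: "psi ^ k > 0" by simp
    obtain u1' u2' v where IH': "u1 \<le> u1'" "u2' \<le> u2" "d1 * psi ^ k \<le> u2' - u1'"
      and v: "\<And>i u x L. i \<in> A \<Longrightarrow> u \<in> {u1'..u2'} \<Longrightarrow> x \<in> {\<xi> - d1 * psi ^ k..\<xi> + d1 * psi ^ k} \<Longrightarrow> k + M1 \<le> L \<Longrightarrow>
        g L (x + c i * u + r i + psi ^ k) = g L (x + c i * u + r i) + of_int (v i)"
      using IH[OF k u, of \<xi> r] by blast
    \<comment> \<open>No truncation: \<open>k\<close> is odd, hence positive.\<close>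
    define l where "l = k + q - 1"
    have l: "l + 1 = k + q" "l + 2 = k + (q + 1)" "l + 3 = k + (q + 2)" using k by (cases k; simp add: l_def)+
    define a b where "a = \<xi> + c j * u1' + r j" and "b = \<xi> + c j * u2' + r j"
    have "4 * psi ^ (l + 1) = (4 * psi ^ q) * psi ^ k" unfolding l(1) by (simp add: power_add)
    also have "\<dots> \<le> d1 * psi ^ k" using q pk by (intro mult_right_mono) linarith+
    also have "\<dots> \<le> u2' - u1'" by (rule IH')
    also have "\<dots> \<le> c j * (u2' - u1')"
    proof -
      have "0 \<le> u2' - u1'" using IH'(3) mult_pos_pos[OF d1 pk] by linarith
      then show ?thesis using mult_right_mono[OF cj] by simp
    qed
    also have "\<dots> = b - a" by (simp add: a_def b_def algebra_simps)
    finally have "4 * psi ^ (l + 1) \<le> b - a" .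
    moreover have "k \<le> l + 1" using l(1) by simp
    ultimately obtain a' b' w where ab: "a \<le> a'" "b' \<le> b" "b' - a' = psi ^ (l + 2)"
      and w: "\<And>p L. p \<in> {a'..<b'} \<Longrightarrow> l + 3 \<le> L \<Longrightarrow> g L (p + psi ^ k) = g L p + of_int w"
      using ex_constant_diff_interval[OF k, where l = l and a = a and b = b] by blast
    have len: "b' - a' = 4 * (\<delta> * psi ^ k)" unfolding ab(3) l(2) \<delta>_def by (simp add: power_add)
    define D where "D = \<delta> * psi ^ k"
    have D: "D > 0" using \<delta> by (simp add: D_def)
    \<comment> \<open>The interval of constancy has length \<open>4 * D\<close>. Margins
      \<open>D\<close> and \<open>2 * D\<close> let \<open>x\<close> vary by \<open>D\<close> to
      either side and keep the right end excluded; length \<open>D\<close> is left for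
      \<open>c j * u\<close>.\<close>
    define w1 w2 where "w1 = (a' + D - \<xi> - r j) / c j" and "w2 = (b' - 2 * D - \<xi> - r j) / c j"
    have cw: "c j * w1 = a' + D - \<xi> - r j" "c j * w2 = b' - 2 * D - \<xi> - r j"
      using cj by (auto simp: w1_def w2_def)
    have "c j * u1' \<le> c j * w1" "c j * w2 \<le> c j * u2'"
      unfolding cw using ab D by (auto simp: a_def b_def)
    then have w12: "u1' \<le> w1" "w2 \<le> u2'" using cj by auto
    have "c j * (d2 * psi ^ k) \<le> D" unfolding D_def using mult_right_mono[OF d2c, of "psi ^ k"] pk
      by (simp add: mult.assoc)
    also have "D = c j * (w2 - w1)" using cw len by (simp add: D_def algebra_simps)
    finally have "d2 * psi ^ k \<le> w2 - w1" using cj by simp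
    moreover have dk: "d2 * psi ^ k \<le> d1 * psi ^ k" "d2 * psi ^ k \<le> D"
      using d2 by (auto simp: D_def intro!: mult_right_mono)
    have "g L (x + c i * u + r i + psi ^ k) = g L (x + c i * u + r i) + of_int ((v(j := w)) i)"
      if i: "i \<in> insert j A" and u: "u \<in> {w1..w2}" and x: "x \<in> {\<xi> - d2 * psi ^ k..\<xi> + d2 * psi ^ k}"
        and L: "k + max M1 (q + 2) \<le> L" for i u x L
    proof (cases "i = j")
      case True
      have "c j * w1 \<le> c j * u" "c j * u \<le> c j * w2" using u cj by auto
      then have "x + c j * u + r j \<in> {a'..<b'}"
        using x dk(2) D cw unfolding atLeastAtMost_iff atLeastLessThan_iff by linarith
      then show ?thesis using w[of "x + c j * u + r j" L] L l(3) True by simp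
    next
      case False
      then have "i \<in> A" using i by simp
      moreover have "u \<in> {u1'..u2'}" using u w12 by auto
      moreover have "x \<in> {\<xi> - d1 * psi ^ k..\<xi> + d1 * psi ^ k}"
        using x dk(1) unfolding atLeastAtMost_iff by linarith
      moreover have "k + M1 \<le> L" using L by simp
      ultimately show ?thesis using v False by simp
    qed
    ultimately show "\<exists>u1' u2' (v :: 'i \<Rightarrow> int). u1 \<le> u1' \<and> u2' \<le> u2 \<and> d2 * psi ^ k \<le> u2' - u1' \<and>
      (\<forall>i\<in>insert j A. \<forall>u\<in>{u1'..u2'}. \<forall>x\<in>{\<xi> - d2 * psi ^ k..\<xi> + d2 * psi ^ k}. \<forall>L\<ge>k + max M1 (q + 2).
        g L (x + c i * u + r i + psi ^ k) = g L (x + c i * u + r i) + of_int (v i))"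
      using w12 IH' by (intro exI[of _ w1] exI[of _ w2] exI[of _ "v(j := w)"]) auto
  qed
qed

section \<open>Boxes around a jump\<close>

lemma psi_le_two_thirds: "psi \<le> 2 / 3"
proof -
  have "sqrt 5 \<le> 7 / 3" by (rule real_le_lsqrt) (auto simp: power2_eq_square)
  then show ?thesis by (simp add: psi_def golden_def)
qed

text \<open>The extra vertex with shift \<open>r0\<close> does not involve \<open>u\<close>, so its
  jump fixes \<open>\<xi>\<close> first, and the box for the others is placed in \<open>u\<close>
  afterwards. Evenness of \<open>m\<close> keeps \<open>k + m\<close> odd for the next
  scale.\<close>

lemma ex_box_around_jump:
  fixes c :: "'i \<Rightarrow> real"
  assumes "finite A" "\<forall>i\<in>A. 1 \<le> c i"
  shows "\<exists>m. even m \<and> m > 0 \<and> (\<forall>k r r0 x0 x1 u0 u1. odd k \<longrightarrow> 3 \<le> k \<longrightarrow>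
    16 * psi ^ k \<le> x1 - x0 \<longrightarrow> 16 * psi ^ k \<le> u1 - u0 \<longrightarrow>
    (let h = 16 * psi ^ (k + m) in 2 * h \<le> psi ^ k \<and>
    (\<exists>\<xi> \<upsilon> (v :: 'i \<Rightarrow> int). x0 + 2 * h \<le> \<xi> \<and> \<xi> + 2 * h + psi ^ k \<le> x1 \<and>
      u0 + h \<le> \<upsilon> \<and> \<upsilon> + 2 * h \<le> u1 \<and>
      (\<forall>L\<ge>k + m. \<forall>u\<in>{\<upsilon>..<\<upsilon> + h}. \<forall>x\<in>{\<xi> - h..<\<xi> + h}.
        (\<forall>i\<in>A. g L (x + c i * u + r i + psi ^ k) = g L (x + c i * u + r i) + of_int (v i)) \<and>
        g L (x + r0 + psi ^ k) = g L (x + r0) + (if x < \<xi> then 0 else 1)))))"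
proof -
  obtain d M where d: "d > 0" and box: "\<forall>k r \<xi> u1 u2. odd k \<longrightarrow> 1 * psi ^ k \<le> u2 - u1 \<longrightarrow>
    (\<exists>u1' u2' (v :: 'i \<Rightarrow> int). u1 \<le> u1' \<and> u2' \<le> u2 \<and> d * psi ^ k \<le> u2' - u1' \<and>
      (\<forall>i\<in>A. \<forall>u\<in>{u1'..u2'}. \<forall>x\<in>{\<xi> - d * psi ^ k..\<xi> + d * psi ^ k}. \<forall>L\<ge>k + M.
        g L (x + c i * u + r i + psi ^ k) = g L (x + c i * u + r i) + of_int (v i)))"
    using ex_constant_diff_box[where A = A and c = c, OF assms zero_less_one]
    by (elim exE conjE) (rule that)
  \<comment> \<open>The three bounds make \<open>h\<close> small enough for the box of the other
    vertices, for the margins and the interval to the right of the jump, and for the shorter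
    interval to its left.\<close>
  define \<epsilon> where "\<epsilon> = min d (min (1/4) (psi ^ 2)) / 16"
  have "\<epsilon> > 0" using d psi_bounds by (simp add: \<epsilon>_def)
  then obtain m0 where m0: "psi ^ m0 < \<epsilon>" using ex_psi_power_less by blast
  define m where "m = 2 * (m0 + M + 3)"
  have "psi ^ m \<le> psi ^ m0" using psi_bounds by (intro power_decreasing) (auto simp: m_def)
  then have "psi ^ m \<le> \<epsilon>" using m0 by simp
  then have m: "16 * psi ^ m \<le> d" "16 * psi ^ m \<le> 1/4" "16 * psi ^ m \<le> psi ^ 2" by (auto simp: \<epsilon>_def)
  show ?thesis
  proof (rule exI[of _ m], intro conjI allI impI)
    show "even m" "m > 0" by (auto simp: m_def)
    fix k :: nat and r :: "'i \<Rightarrow> real" and r0 x0 x1 u0 u1 :: real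
    assume k: "odd k" "3 \<le> k" and x01: "16 * psi ^ k \<le> x1 - x0" and u01: "16 * psi ^ k \<le> u1 - u0"
    define p where "p = psi ^ k"
    have p: "p > 0" by (simp add: p_def)
    define h where "h = 16 * psi ^ (k + m)"
    have heq: "h = (16 * psi ^ m) * p" by (simp add: h_def p_def power_add)
    have h: "h > 0" "h \<le> d * p" "h \<le> p / 4" "h \<le> psi ^ (k + 2)"
    proof -
      show "h > 0" by (simp add: h_def)
      show "h \<le> d * p" unfolding heq using m(1) p by (intro mult_right_mono) auto
      show "h \<le> p / 4" unfolding heq using mult_right_mono[OF m(2), of p] p by simp
      have "psi ^ (k + 2) = psi ^ 2 * p" by (simp add: p_def power_add power2_eq_square)
      then show "h \<le> psi ^ (k + 2)" unfolding heq using m(3) p by (simp only:) (intro mult_right_mono; simp)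
    qed
    \<comment> \<open>The jump is sought around the midpoint of a side \<open>16 * p\<close>; it is
      off by at most \<open>6 * p\<close>, because \<open>psi ^ 2\<close> is at least 1/3.\<close>
    obtain z where z: "\<bar>z - (x0 + 8 * p + r0)\<bar> \<le> 2 * psi ^ (k - 2)"
      and jump: "\<And>L x. k + 3 \<le> L \<Longrightarrow> x \<in> {z - psi ^ (k + 2)..<z} \<Longrightarrow> g L (x + psi ^ k) = g L x"
        "\<And>L x. k + 3 \<le> L \<Longrightarrow> x \<in> {z..<z + psi ^ k} \<Longrightarrow> g L (x + psi ^ k) = g L x + 1"
      using ex_jump_point[OF k, of "x0 + 8 * p + r0"] by blast
    define \<xi> where "\<xi> = z - r0"
    have "2 * psi ^ (k - 2) \<le> 6 * p"
    proof -
      have "k - 2 + 2 = k" using k by simp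
      then have "p = psi ^ (k - 2) * psi\<^sup>2"
        unfolding p_def using power_add[of psi "k - 2" 2] by (simp only:)
      also have "\<dots> \<ge> psi ^ (k - 2) * (1 / 3)"
        using psi_sq psi_le_two_thirds psi_bounds by (intro mult_left_mono) auto
      finally show ?thesis by simp
    qed
    then have \<xi>: "x0 + 2 * p \<le> \<xi>" "\<xi> \<le> x0 + 14 * p" using z unfolding \<xi>_def by linarith+
    \<comment> \<open>The margins \<open>p\<close> keep the strips on both sides of the box at least
      \<open>h\<close> wide.\<close>
    have "1 * psi ^ k \<le> (u1 - p) - (u0 + p)" using u01 p unfolding p_def[symmetric] by linarith
    from box[THEN spec[of _ k], THEN spec[of _ r], THEN spec[of _ \<xi>], THEN spec[of _ "u0 + p"],
        THEN spec[of _ "u1 - p"], THEN mp, OF k(1), THEN mp, OF this]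
    obtain \<upsilon> u2' v where \<upsilon>: "u0 + p \<le> \<upsilon>" "u2' \<le> u1 - p" "d * psi ^ k \<le> u2' - \<upsilon>"
      and v: "\<forall>i\<in>A. \<forall>u\<in>{\<upsilon>..u2'}. \<forall>x\<in>{\<xi> - d * psi ^ k..\<xi> + d * psi ^ k}. \<forall>L\<ge>k + M.
        g L (x + c i * u + r i + psi ^ k) = g L (x + c i * u + r i) + of_int (v i)"
      by (elim exE conjE) (rule that)
    have hd: "h \<le> u2' - \<upsilon>" using \<upsilon>(3) h(2) by (simp add: p_def)
    have "(\<forall>i\<in>A. g L (x + c i * u + r i + psi ^ k) = g L (x + c i * u + r i) + of_int (v i)) \<and>
        g L (x + r0 + psi ^ k) = g L (x + r0) + (if x < \<xi> then 0 else 1)"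
      if L: "k + m \<le> L" and u: "u \<in> {\<upsilon>..<\<upsilon> + h}" and x: "x \<in> {\<xi> - h..<\<xi> + h}" for L u x
    proof
      have "u \<in> {\<upsilon>..u2'}" using u hd by auto
      moreover have "x \<in> {\<xi> - d * psi ^ k..\<xi> + d * psi ^ k}" using x h(2) by (auto simp: p_def)
      moreover have "k + M \<le> L" using L by (simp add: m_def)
      ultimately show "\<forall>i\<in>A. g L (x + c i * u + r i + psi ^ k) = g L (x + c i * u + r i) + of_int (v i)"
        using v by blast
      have L3: "k + 3 \<le> L" using L by (simp add: m_def)
      show "g L (x + r0 + psi ^ k) = g L (x + r0) + (if x < \<xi> then 0 else 1)"
      proof (cases "x < \<xi>")
        case True
        then have "x + r0 \<in> {z - psi ^ (k + 2)..<z}" using x h(4) by (auto simp: \<xi>_def)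
        then show ?thesis using jump(1)[OF L3] True by simp
      next
        case False
        then have "x + r0 \<in> {z..<z + psi ^ k}" using x h(3) p by (auto simp: \<xi>_def p_def)
        then show ?thesis using jump(2)[OF L3] False by simp
      qed
    qed
    moreover have "x0 + 2 * h \<le> \<xi>" "\<xi> + 2 * h + psi ^ k \<le> x1" "u0 + h \<le> \<upsilon>" "\<upsilon> + 2 * h \<le> u1"
      "2 * h \<le> psi ^ k"
      using h p \<xi> \<upsilon> hd x01 unfolding p_def[symmetric] by linarith+
    ultimately show "let h = 16 * psi ^ (k + m) in 2 * h \<le> psi ^ k \<and>
    (\<exists>\<xi> \<upsilon> (v :: 'i \<Rightarrow> int). x0 + 2 * h \<le> \<xi> \<and> \<xi> + 2 * h + psi ^ k \<le> x1 \<and>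
      u0 + h \<le> \<upsilon> \<and> \<upsilon> + 2 * h \<le> u1 \<and>
      (\<forall>L\<ge>k + m. \<forall>u\<in>{\<upsilon>..<\<upsilon> + h}. \<forall>x\<in>{\<xi> - h..<\<xi> + h}.
        (\<forall>i\<in>A. g L (x + c i * u + r i + psi ^ k) = g L (x + c i * u + r i) + of_int (v i)) \<and>
        g L (x + r0 + psi ^ k) = g L (x + r0) + (if x < \<xi> then 0 else 1)))"
      unfolding Let_def h_def[symmetric] by blast
  qed
qed

section \<open>Integrals over boxes\<close>

lemma
  fixes f :: "'a \<Rightarrow> complex"
  assumes A: "A \<in> sets M" "emeasure M A < \<infinity>" and f: "f \<in> borel_measurable M"
    and B: "\<And>x. x \<in> A \<Longrightarrow> cmod (f x) \<le> B"
  shows set_integrable_bounded: "set_integrable M A f"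
    and norm_set_integral_le: "cmod (LINT x:A|M. f x) \<le> B * measure M A"
proof -
  show i: "set_integrable M A f"
    unfolding set_integrable_def
    by (rule integrableI_bounded_set_indicator[where B = B]) (use f B A in auto)
  have "cmod (LINT x:A|M. f x) \<le> (LINT x:A|M. cmod (f x))"
    by (rule set_integral_norm_bound[OF i])
  also have "\<dots> \<le> (LINT x:A|M. B)"
  proof (rule set_integral_mono)
    show "set_integrable M A (\<lambda>x. cmod (f x))" using i by (rule set_integrable_norm)
    show "set_integrable M A (\<lambda>x. B)" unfolding set_integrable_def using A by simp
  qed (use B in auto)
  also have "\<dots> = B * measure M A" using A by (simp add: set_lebesgue_integral_def)
  finally show "cmod (LINT x:A|M. f x) \<le> B * measure M A" .
qed

lemma
  fixes f :: "real \<Rightarrow> complex"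
  assumes f: "f \<in> borel_measurable borel" and B: "\<And>x. x \<in> {a..<b} \<Longrightarrow> cmod (f x) \<le> B" and ab: "a \<le> b"
  shows set_integrable_interval: "set_integrable lborel {a..<b} f"
    and norm_set_integral_interval_le: "cmod (LINT x:{a..<b}|lborel. f x) \<le> B * (b - a)"
  using set_integrable_bounded[of "{a..<b}" lborel f B] norm_set_integral_le[of "{a..<b}" lborel f B]
    f B ab by auto

lemma set_integral_interval_shift:
  fixes f :: "real \<Rightarrow> complex"
  shows "(LINT x:{a + t..<b + t}|lborel. f x) = (LINT x:{a..<b}|lborel. f (x + t))"
proof -
  have "(LINT x:{a + t..<b + t}|lborel. f x) =
      (\<integral>x. indicator {a + t..<b + t} (t + 1 * x) *\<^sub>R f (t + 1 * x) \<partial>lborel)"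
    unfolding set_lebesgue_integral_def by (subst lborel_integral_real_affine[where c = 1 and t = t]) auto
  also have "\<dots> = (LINT x:{a..<b}|lborel. f (x + t))"
    unfolding set_lebesgue_integral_def
    by (intro Bochner_Integration.integral_cong) (auto simp: indicator_def add.commute)
  finally show ?thesis .
qed

text \<open>Pieces of length \<open>h\<close> are cut off as long as more than \<open>2 * h\<close>
  remains, so the last piece has length between \<open>h\<close> and \<open>2 * h\<close>.\<close>

lemma interval_tiling:
  fixes h :: real
  assumes h: "0 < h"
    and short: "\<And>a b. h \<le> b - a \<Longrightarrow> b - a \<le> 2 * h \<Longrightarrow> P a b"
    and join: "\<And>a b c. h \<le> b - a \<Longrightarrow> h \<le> c - b \<Longrightarrow> P a b \<Longrightarrow> P b c \<Longrightarrow> P a c"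
    and ab: "h \<le> b - a"
  shows "P a b"
proof -
  have "P a b" if "h \<le> b - a" "b - a \<le> (real n + 2) * h" for n a b
    using that
  proof (induction n arbitrary: a b)
    case 0
    then show ?case using short by simp
  next
    case (Suc n)
    show ?case
    proof (cases "b - a \<le> 2 * h")
      case True
      then show ?thesis using Suc.prems short by blast
    next
      case False
      have "P a (a + h)" using h by (intro short) auto
      moreover have "P (a + h) b"
        using False Suc.prems by (intro Suc.IH) (auto simp: algebra_simps)
      ultimately show ?thesis using False h by (intro join[of "a + h" a b]) auto
    qed
  qed
  moreover obtain n :: nat where "(b - a) / h \<le> real n" using real_arch_simple by blast
  then have "b - a \<le> (real n + 2) * h" using h by (simp add: field_simps)
  ultimately show ?thesis using ab by blast
qed

section \<open>Rectangle integrals of a bounded kernel\<close>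

locale bounded_kernel =
  fixes F :: "real \<Rightarrow> real \<Rightarrow> complex"
  assumes measurable_kernel: "(\<lambda>(x, u). F x u) \<in> borel_measurable (borel \<Otimes>\<^sub>M borel)"
    and norm_kernel_le: "cmod (F x u) \<le> 1"
begin

definition row_integral :: "real \<Rightarrow> real \<Rightarrow> real \<Rightarrow> complex" where
  "row_integral x0 x1 u = (LINT x:{x0..<x1}|lborel. F x u)"

definition rect_integral :: "real \<Rightarrow> real \<Rightarrow> real \<Rightarrow> real \<Rightarrow> complex" where
  "rect_integral x0 x1 u0 u1 = (LINT u:{u0..<u1}|lborel. row_integral x0 x1 u)"

lemma measurable_row: "(\<lambda>x. F x u) \<in> borel_measurable borel"
proof -
  have "(\<lambda>x. (\<lambda>(x, u). F x u) (x, u)) \<in> borel_measurable borel"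
    by (rule measurable_compose[OF _ measurable_kernel]) simp
  then show ?thesis by simp
qed

lemma measurable_row_integral: "row_integral x0 x1 \<in> borel_measurable borel"
proof -
  have "(\<lambda>(u, x). F x u) \<in> borel_measurable (borel \<Otimes>\<^sub>M lborel)"
    using measurable_compose[OF measurable_pair_swap' measurable_kernel]
    by (simp add: case_prod_beta' measurable_lborel1 cong: measurable_cong_sets)
  then have "(\<lambda>(u, x). indicator {x0..<x1} x *\<^sub>R F x u) \<in> borel_measurable (borel \<Otimes>\<^sub>M lborel)"
    by (simp add: case_prod_beta') measurable
  then have "(\<lambda>u. \<integral>x. indicator {x0..<x1} x *\<^sub>R F x u \<partial>lborel) \<in> borel_measurable borel"
    by (rule lborel.borel_measurable_lebesgue_integral)
  then show ?thesis unfolding row_integral_def set_lebesgue_integral_def .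
qed

lemma norm_row_integral_le: "x0 \<le> x1 \<Longrightarrow> cmod (row_integral x0 x1 u) \<le> x1 - x0"
  unfolding row_integral_def
  using norm_set_integral_interval_le[OF measurable_row, of x0 x1 u 1] norm_kernel_le by simp

lemma row_integral_split:
  assumes "x0 \<le> x1" "x1 \<le> x2"
  shows "row_integral x0 x2 u = row_integral x0 x1 u + row_integral x1 x2 u"
proof -
  have "{x0..<x2} = {x0..<x1} \<union> {x1..<x2}" using assms by auto
  then show ?thesis unfolding row_integral_def
    by (simp only:) (rule set_integral_Un; (rule set_integrable_interval[OF measurable_row norm_kernel_le])?; use assms in auto)
qed

lemma set_integrable_row_integral:
  "x0 \<le> x1 \<Longrightarrow> u0 \<le> u1 \<Longrightarrow> set_integrable lborel {u0..<u1} (row_integral x0 x1)"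
  by (rule set_integrable_interval[OF measurable_row_integral norm_row_integral_le])

lemma rect_integral_split_row:
  assumes "x0 \<le> x1" "x1 \<le> x2" "u0 \<le> u1"
  shows "rect_integral x0 x2 u0 u1 = rect_integral x0 x1 u0 u1 + rect_integral x1 x2 u0 u1"
  unfolding rect_integral_def row_integral_split[OF assms(1,2)]
  by (rule set_integral_add) (use assms set_integrable_row_integral in auto)

lemma rect_integral_split_col:
  assumes "x0 \<le> x1" "u0 \<le> u1" "u1 \<le> u2"
  shows "rect_integral x0 x1 u0 u2 = rect_integral x0 x1 u0 u1 + rect_integral x0 x1 u1 u2"
proof -
  have "{u0..<u2} = {u0..<u1} \<union> {u1..<u2}" using assms by auto
  then show ?thesis unfolding rect_integral_def
    by (simp only:) (rule set_integral_Un; (rule set_integrable_row_integral)?; use assms in auto)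
qed

lemma norm_rect_integral_le:
  "x0 \<le> x1 \<Longrightarrow> u0 \<le> u1 \<Longrightarrow> cmod (rect_integral x0 x1 u0 u1) \<le> (x1 - x0) * (u1 - u0)"
  unfolding rect_integral_def
  by (rule norm_set_integral_interval_le[OF measurable_row_integral norm_row_integral_le])

lemma rect_integral_shift:
  assumes "\<And>x u. x \<in> {x0..<x1} \<Longrightarrow> u \<in> {u0..<u1} \<Longrightarrow> F (x + t) u = w * F x u"
  shows "rect_integral (x0 + t) (x1 + t) u0 u1 = w * rect_integral x0 x1 u0 u1"
proof -
  have row: "row_integral (x0 + t) (x1 + t) u = w * row_integral x0 x1 u" if "u \<in> {u0..<u1}" for u
  proof -
    have "row_integral (x0 + t) (x1 + t) u = (LINT x:{x0..<x1}|lborel. w * F x u)"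
      unfolding row_integral_def set_integral_interval_shift
      by (rule set_lebesgue_integral_cong) (use assms that in auto)
    then show ?thesis by (simp add: row_integral_def)
  qed
  have "rect_integral (x0 + t) (x1 + t) u0 u1 = (LINT u:{u0..<u1}|lborel. w * row_integral x0 x1 u)"
    unfolding rect_integral_def by (rule set_lebesgue_integral_cong) (use row in auto)
  then show ?thesis by (simp add: rect_integral_def)
qed

definition box_bound :: "real \<Rightarrow> real \<Rightarrow> bool" where
  "box_bound q h \<longleftrightarrow> (\<forall>x0 x1 u0 u1. h \<le> x1 - x0 \<longrightarrow> h \<le> u1 - u0 \<longrightarrow>
    cmod (rect_integral x0 x1 u0 u1) \<le> q * ((x1 - x0) * (u1 - u0)))"

lemma box_bound_1: "0 \<le> h \<Longrightarrow> box_bound 1 h"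
  unfolding box_bound_def using norm_rect_integral_le by simp

text \<open>The bound is additive in the area, so tiling first along \<open>u\<close> and then along
  \<open>x\<close> reduces to sides between \<open>h\<close> and \<open>2 * h\<close>.\<close>

lemma box_boundI:
  assumes h: "0 < h"
    and small: "\<And>x0 x1 u0 u1. h \<le> x1 - x0 \<Longrightarrow> x1 - x0 \<le> 2 * h \<Longrightarrow> h \<le> u1 - u0 \<Longrightarrow> u1 - u0 \<le> 2 * h \<Longrightarrow>
      cmod (rect_integral x0 x1 u0 u1) \<le> q * ((x1 - x0) * (u1 - u0))"
  shows "box_bound q h"
  unfolding box_bound_def
proof (intro allI impI)
  fix x0 x1 u0 u1 :: real
  assume x: "h \<le> x1 - x0" and u: "h \<le> u1 - u0"
  have col: "cmod (rect_integral x0 x1 u0 u1) \<le> q * ((x1 - x0) * (u1 - u0))"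
    if x: "h \<le> x1 - x0" "x1 - x0 \<le> 2 * h" for x0 x1
  proof (rule interval_tiling[OF h _ _ u])
    fix a b c assume "h \<le> b - a" "h \<le> c - b"
      and *: "cmod (rect_integral x0 x1 a b) \<le> q * ((x1 - x0) * (b - a))"
        "cmod (rect_integral x0 x1 b c) \<le> q * ((x1 - x0) * (c - b))"
    then have "rect_integral x0 x1 a c = rect_integral x0 x1 a b + rect_integral x0 x1 b c"
      using h x by (intro rect_integral_split_col) auto
    then have "cmod (rect_integral x0 x1 a c) \<le> q * ((x1 - x0) * (b - a)) + q * ((x1 - x0) * (c - b))"
      using * by (simp only:) (intro norm_triangle_mono)
    then show "cmod (rect_integral x0 x1 a c) \<le> q * ((x1 - x0) * (c - a))"
      by (simp add: algebra_simps)
  qed (use small x in blast)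
  show "cmod (rect_integral x0 x1 u0 u1) \<le> q * ((x1 - x0) * (u1 - u0))"
  proof (rule interval_tiling[OF h _ _ x])
    fix a b c assume "h \<le> b - a" "h \<le> c - b"
      and *: "cmod (rect_integral a b u0 u1) \<le> q * ((b - a) * (u1 - u0))"
        "cmod (rect_integral b c u0 u1) \<le> q * ((c - b) * (u1 - u0))"
    then have "rect_integral a c u0 u1 = rect_integral a b u0 u1 + rect_integral b c u0 u1"
      using h u by (intro rect_integral_split_row) auto
    then have "cmod (rect_integral a c u0 u1) \<le> q * ((b - a) * (u1 - u0)) + q * ((c - b) * (u1 - u0))"
      using * by (simp only:) (intro norm_triangle_mono)
    then show "cmod (rect_integral a c u0 u1) \<le> q * ((c - a) * (u1 - u0))"
      by (simp add: algebra_simps)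
  qed (use col in blast)
qed

text \<open>A box contributes less than its share because it contains two congruent boxes on
  which \<open>F\<close> agrees up to a constant factor \<open>w\<close> that is not close to 1.\<close>

lemma box_bound_step:
  assumes bb: "box_bound q h" and q: "0 \<le> q" and h: "0 < h" "h \<le> H" and \<delta>: "0 \<le> \<delta>"
    and pair: "\<And>x0 x1 u0 u1. H \<le> x1 - x0 \<Longrightarrow> H \<le> u1 - u0 \<Longrightarrow>
      \<exists>\<xi> \<upsilon> t w. x0 + h \<le> \<xi> \<and> \<xi> + 2 * h + t \<le> x1 \<and> 2 * h \<le> t \<and> u0 + h \<le> \<upsilon> \<and> \<upsilon> + 2 * h \<le> u1 \<and>
        cmod (1 + w) \<le> 2 - \<delta> \<and> (\<forall>u\<in>{\<upsilon>..<\<upsilon> + h}. \<forall>x\<in>{\<xi>..<\<xi> + h}. F (x + t) u = w * F x u)"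
  shows "box_bound (q * (1 - \<delta> * (h / (2 * H))\<^sup>2)) H"
proof (rule box_boundI)
  show "0 < H" using h by simp
  fix x0 x1 u0 u1 assume x: "H \<le> x1 - x0" "x1 - x0 \<le> 2 * H" and u: "H \<le> u1 - u0" "u1 - u0 \<le> 2 * H"
  obtain \<xi> \<upsilon> t w where 1: "x0 + h \<le> \<xi>" "\<xi> + 2 * h + t \<le> x1" "2 * h \<le> t" "u0 + h \<le> \<upsilon>" "\<upsilon> + 2 * h \<le> u1"
      "cmod (1 + w) \<le> 2 - \<delta>"
    and eq: "\<forall>u\<in>{\<upsilon>..<\<upsilon> + h}. \<forall>x\<in>{\<xi>..<\<xi> + h}. F (x + t) u = w * F x u"
    using pair[OF x(1) u(1)] by blast
  have B: "cmod (rect_integral a b c d) \<le> q * ((b - a) * (d - c))" if "h \<le> b - a" "h \<le> d - c" for a b c d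
    using bb that by (auto simp: box_bound_def)
  let ?Q = "rect_integral \<xi> (\<xi> + h) \<upsilon> (\<upsilon> + h)"
  have shift: "rect_integral (\<xi> + t) (\<xi> + t + h) \<upsilon> (\<upsilon> + h) = w * ?Q"
    using rect_integral_shift[of \<xi> "\<xi> + h" \<upsilon> "\<upsilon> + h" t w] eq by (simp add: algebra_simps)
  \<comment> \<open>Two strips of full width and a middle strip of height \<open>h\<close>, which is
    cut at the two congruent boxes. By the margins and \<open>2 * h \<le> t\<close> every piece has
    sides at least \<open>h\<close>, so \<open>B\<close> applies to each.\<close>
  have "rect_integral x0 x1 u0 u1 =
      rect_integral x0 x1 u0 \<upsilon> + rect_integral x0 x1 \<upsilon> (\<upsilon> + h) + rect_integral x0 x1 (\<upsilon> + h) u1"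
    using 1 h rect_integral_split_col[of x0 x1 u0 \<upsilon> u1] rect_integral_split_col[of x0 x1 \<upsilon> "\<upsilon> + h" u1]
    by simp
  also have "rect_integral x0 x1 \<upsilon> (\<upsilon> + h) =
      rect_integral x0 \<xi> \<upsilon> (\<upsilon> + h) + ?Q + rect_integral (\<xi> + h) (\<xi> + t) \<upsilon> (\<upsilon> + h) +
      rect_integral (\<xi> + t) (\<xi> + t + h) \<upsilon> (\<upsilon> + h) + rect_integral (\<xi> + t + h) x1 \<upsilon> (\<upsilon> + h)"
    using 1 h rect_integral_split_row[of x0 \<xi> x1 \<upsilon> "\<upsilon> + h"]
      rect_integral_split_row[of \<xi> "\<xi> + h" x1 \<upsilon> "\<upsilon> + h"]
      rect_integral_split_row[of "\<xi> + h" "\<xi> + t" x1 \<upsilon> "\<upsilon> + h"]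
      rect_integral_split_row[of "\<xi> + t" "\<xi> + t + h" x1 \<upsilon> "\<upsilon> + h"]
    by simp
  finally have split: "rect_integral x0 x1 u0 u1 =
      rect_integral x0 x1 u0 \<upsilon> + rect_integral x0 x1 (\<upsilon> + h) u1 +
      rect_integral x0 \<xi> \<upsilon> (\<upsilon> + h) + rect_integral (\<xi> + h) (\<xi> + t) \<upsilon> (\<upsilon> + h) +
      rect_integral (\<xi> + t + h) x1 \<upsilon> (\<upsilon> + h) + (1 + w) * ?Q"
    unfolding shift by (simp add: algebra_simps)
  have "cmod ((1 + w) * ?Q) \<le> (2 - \<delta>) * (q * (h * h))"
    unfolding norm_mult
    using 1(6) order_trans[OF norm_ge_zero 1(6)]
      B[where a = \<xi> and b = "\<xi> + h" and c = \<upsilon> and d = "\<upsilon> + h"]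
    by (intro mult_mono) (auto intro: order_trans[OF norm_ge_zero])
  then have "cmod (rect_integral x0 x1 u0 u1) \<le>
      q * ((x1 - x0) * (\<upsilon> - u0)) + q * ((x1 - x0) * (u1 - (\<upsilon> + h))) +
      q * ((\<xi> - x0) * h) + q * ((\<xi> + t - (\<xi> + h)) * h) + q * ((x1 - (\<xi> + t + h)) * h) + (2 - \<delta>) * (q * (h * h))"
    unfolding split
    using B[where a = x0 and b = x1 and c = u0 and d = \<upsilon>]
      B[where a = x0 and b = x1 and c = "\<upsilon> + h" and d = u1]
      B[where a = x0 and b = \<xi> and c = \<upsilon> and d = "\<upsilon> + h"]
      B[where a = "\<xi> + h" and b = "\<xi> + t" and c = \<upsilon> and d = "\<upsilon> + h"]
      B[where a = "\<xi> + t + h" and b = x1 and c = \<upsilon> and d = "\<upsilon> + h"] 1 h x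
    by (intro norm_triangle_mono) auto
  also have "\<dots> = q * ((x1 - x0) * (u1 - u0) - \<delta> * h\<^sup>2)"
    by (simp add: algebra_simps power2_eq_square)
  also have "\<dots> \<le> q * ((x1 - x0) * (u1 - u0) - \<delta> * ((h / (2 * H))\<^sup>2 * ((x1 - x0) * (u1 - u0))))"
  proof -
    \<comment> \<open>Sides at most \<open>2 * H\<close> turn the absolute saving of
      \<open>\<delta> * h^2\<close> into a fixed proportion of the area.\<close>
    have "(x1 - x0) * (u1 - u0) \<le> (2 * H) * (2 * H)" using x u h by (intro mult_mono) auto
    then have "(h / (2 * H))\<^sup>2 * ((x1 - x0) * (u1 - u0)) \<le> (h / (2 * H))\<^sup>2 * ((2 * H) * (2 * H))"
      by (intro mult_left_mono) auto
    also have "\<dots> = h\<^sup>2" using h by (simp add: power2_eq_square field_simps)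
    finally show ?thesis using \<delta> q by (intro mult_left_mono diff_left_mono) auto
  qed
  also have "\<dots> = q * (1 - \<delta> * (h / (2 * H))\<^sup>2) * ((x1 - x0) * (u1 - u0))"
    by (simp add: algebra_simps)
  finally show "cmod (rect_integral x0 x1 u0 u1) \<le> \<dots>" .
qed

end

section \<open>Decay of the two-dimensional integrals\<close>

lemma borel_measurable_e [measurable]: "e \<in> borel_measurable borel"
  unfolding e_def by measurable

text \<open>With \<open>V\<close> the set of vertices, \<open>\<theta> * phase\<close> is the
  argument of the product in the Gowers integral: \<open>\<sigma>\<close> records the conjugations,
  \<open>c\<close> the speed with which a vertex moves with \<open>u\<close>, and \<open>r\<close>
  its fixed shift.\<close>

definition phase :: "'i set \<Rightarrow> ('i \<Rightarrow> int) \<Rightarrow> ('i \<Rightarrow> real) \<Rightarrow> ('i \<Rightarrow> real) \<Rightarrow> nat \<Rightarrow> real \<Rightarrow> real \<Rightarrow> real" where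
  "phase V \<sigma> c r L x u = (\<Sum>i\<in>V. of_int (\<sigma> i) * g L (x + c i * u + r i))"

lemma bounded_kernel_phase: "bounded_kernel (\<lambda>x u. e (\<theta> * phase V \<sigma> c r L x u))"
proof
  show "(\<lambda>(x, u). e (\<theta> * phase V \<sigma> c r L x u)) \<in> borel_measurable (borel \<Otimes>\<^sub>M borel)"
    unfolding phase_def by measurable
qed simp

text \<open>Induction from fine to coarse scales, starting from the trivial bound 1: each of the
  \<open>n\<close> steps enlarges the side from \<open>16 * psi ^ (k + m)\<close> to
  \<open>16 * psi ^ k\<close> and contributes one factor. The ratio of the sides, hence the factor,
  does not depend on \<open>k\<close>.\<close>

lemma phase_box_bound:
  fixes c :: "'i \<Rightarrow> real" and \<sigma> :: "'i \<Rightarrow> int"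
  assumes A: "finite A" "j \<notin> A" and c: "\<forall>i\<in>A. 1 \<le> c i" "c j = 0" and \<sigma>: "\<bar>\<sigma> j\<bar> = 1"
  shows "\<exists>m>0. \<forall>\<theta> r L n k. odd k \<longrightarrow> 3 \<le> k \<longrightarrow> k + n * m \<le> L \<longrightarrow>
    bounded_kernel.box_bound (\<lambda>x u. e (\<theta> * phase (insert j A) \<sigma> c r L x u))
      ((1 - (dist_nearest_int \<theta>)\<^sup>2 / 4 * (psi ^ m / 2)\<^sup>2) ^ n) (16 * psi ^ k)"
proof -
  obtain m where m: "even m" "m > 0" and box: "\<forall>k r r0 x0 x1 u0 u1. odd k \<longrightarrow> 3 \<le> k \<longrightarrow>
    16 * psi ^ k \<le> x1 - x0 \<longrightarrow> 16 * psi ^ k \<le> u1 - u0 \<longrightarrow>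
    (let h = 16 * psi ^ (k + m) in 2 * h \<le> psi ^ k \<and>
    (\<exists>\<xi> \<upsilon> (v :: 'i \<Rightarrow> int). x0 + 2 * h \<le> \<xi> \<and> \<xi> + 2 * h + psi ^ k \<le> x1 \<and>
      u0 + h \<le> \<upsilon> \<and> \<upsilon> + 2 * h \<le> u1 \<and>
      (\<forall>L\<ge>k + m. \<forall>u\<in>{\<upsilon>..<\<upsilon> + h}. \<forall>x\<in>{\<xi> - h..<\<xi> + h}.
        (\<forall>i\<in>A. g L (x + c i * u + r i + psi ^ k) = g L (x + c i * u + r i) + of_int (v i)) \<and>
        g L (x + r0 + psi ^ k) = g L (x + r0) + (if x < \<xi> then 0 else 1))))"
    using ex_box_around_jump[OF A(1) c(1)] by (elim exE conjE) (rule that)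
  have "bounded_kernel.box_bound (\<lambda>x u. e (\<theta> * phase (insert j A) \<sigma> c r L x u))
      ((1 - (dist_nearest_int \<theta>)\<^sup>2 / 4 * (psi ^ m / 2)\<^sup>2) ^ n) (16 * psi ^ k)"
    if "odd k" "3 \<le> k" "k + n * m \<le> L" for \<theta> r L n k
    using that
  proof (induction n arbitrary: k)
    case 0
    then show ?case
      using bounded_kernel.box_bound_1[OF bounded_kernel_phase, of "16 * psi ^ k"] psi_bounds by simp
  next
    case (Suc n)
    define F where "F = (\<lambda>x u. e (\<theta> * phase (insert j A) \<sigma> c r L x u))"
    interpret bounded_kernel F unfolding F_def by (rule bounded_kernel_phase)
    define d where "d = dist_nearest_int \<theta>"
    define h where "h = 16 * psi ^ (k + m)"
    define H where "H = 16 * psi ^ k"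
    define q where "q = (1 - d\<^sup>2 / 4 * (psi ^ m / 2)\<^sup>2) ^ n"
    have d: "0 \<le> d" "d \<le> 1/2" unfolding d_def by (rule dist_nearest_int_nonneg dist_nearest_int_le_half)+
    have "psi ^ m \<le> 1" using psi_bounds by (intro power_le_one) auto
    then have "(psi ^ m / 2)\<^sup>2 \<le> (1/2)\<^sup>2" using psi_bounds by (intro power_mono) auto
    moreover have "d\<^sup>2 \<le> (1/2)\<^sup>2" using d by (intro power_mono) auto
    ultimately have "d\<^sup>2 / 4 * (psi ^ m / 2)\<^sup>2 \<le> (1/2)\<^sup>2 / 4 * (1/2)\<^sup>2" by (intro mult_mono) auto
    then have q0: "0 \<le> q" unfolding q_def by (intro zero_le_power) (simp add: power2_eq_square)
    have "box_bound q (16 * psi ^ (k + m))"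
      unfolding F_def q_def d_def by (rule Suc.IH) (use Suc.prems m in auto)
    then have IH: "box_bound q h" by (simp only: h_def)
    have hH: "h / (2 * H) = psi ^ m / 2" using psi_bounds by (simp add: h_def H_def power_add)
    have "psi ^ (k + m) \<le> psi ^ k" using psi_bounds by (intro power_decreasing) auto
    then have h: "0 < h" "h \<le> H" unfolding h_def H_def using psi_bounds by simp_all
    have "box_bound (q * (1 - d\<^sup>2 / 4 * (h / (2 * H))\<^sup>2)) H"
    proof (rule box_bound_step[OF IH q0 h])
      fix x0 x1 u0 u1 assume x: "H \<le> x1 - x0" and u: "H \<le> u1 - u0"
      have "let h = 16 * psi ^ (k + m) in 2 * h \<le> psi ^ k \<and>
        (\<exists>\<xi> \<upsilon> (v :: 'i \<Rightarrow> int). x0 + 2 * h \<le> \<xi> \<and> \<xi> + 2 * h + psi ^ k \<le> x1 \<and>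
          u0 + h \<le> \<upsilon> \<and> \<upsilon> + 2 * h \<le> u1 \<and>
          (\<forall>L\<ge>k + m. \<forall>u\<in>{\<upsilon>..<\<upsilon> + h}. \<forall>x\<in>{\<xi> - h..<\<xi> + h}.
            (\<forall>i\<in>A. g L (x + c i * u + r i + psi ^ k) = g L (x + c i * u + r i) + of_int (v i)) \<and>
            g L (x + r j + psi ^ k) = g L (x + r j) + (if x < \<xi> then 0 else 1)))"
        by (rule box[rule_format, OF Suc.prems(1,2)]) (use x u in \<open>auto simp: H_def\<close>)
      then obtain \<xi> \<upsilon> v where 1: "2 * h \<le> psi ^ k" "x0 + 2 * h \<le> \<xi>" "\<xi> + 2 * h + psi ^ k \<le> x1"
          "u0 + h \<le> \<upsilon>" "\<upsilon> + 2 * h \<le> u1"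
        and inc: "\<forall>L\<ge>k + m. \<forall>u\<in>{\<upsilon>..<\<upsilon> + h}. \<forall>x\<in>{\<xi> - h..<\<xi> + h}.
            (\<forall>i\<in>A. g L (x + c i * u + r i + psi ^ k) = g L (x + c i * u + r i) + of_int (v i)) \<and>
            g L (x + r j + psi ^ k) = g L (x + r j) + (if x < \<xi> then 0 else 1)"
        unfolding Let_def h_def[symmetric] by (elim exE conjE) (rule that)
      define w where "w = real_of_int (\<Sum>i\<in>A. \<sigma> i * v i)"
      obtain s where s: "s \<in> {0, 1}" "cmod (1 + e (\<theta> * (w + of_int (\<sigma> j) * s))) \<le> 2 - d\<^sup>2 / 4"
        using norm_one_plus_e_alternative[OF \<sigma>, of \<theta> w] unfolding d_def by blast
      \<comment> \<open>The left half of the box has jump increment 0, the right half 1; the spare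
        \<open>h\<close> in the margin covers the move to the left.\<close>
      define \<xi>' where "\<xi>' = (if s = 0 then \<xi> - h else \<xi>)"
      have L: "k + m \<le> L" using Suc.prems(3) by simp
      have "F (x + psi ^ k) u = e (\<theta> * (w + of_int (\<sigma> j) * s)) * F x u"
        if u: "u \<in> {\<upsilon>..<\<upsilon> + h}" and x: "x \<in> {\<xi>'..<\<xi>' + h}" for x u
      proof -
        have x': "x \<in> {\<xi> - h..<\<xi> + h}" and side: "(if x < \<xi> then 0 else 1) = s"
          using x s(1) h by (auto simp: \<xi>'_def split: if_splits)
        have gA: "\<forall>i\<in>A. g L (x + c i * u + r i + psi ^ k) = g L (x + c i * u + r i) + of_int (v i)"
          and gj: "g L (x + r j + psi ^ k) = g L (x + r j) + s"
          using inc[rule_format, OF L u x'] side by simp_all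
        have "phase (insert j A) \<sigma> c r L (x + psi ^ k) u =
            of_int (\<sigma> j) * g L (x + r j + psi ^ k) + (\<Sum>i\<in>A. of_int (\<sigma> i) * g L (x + c i * u + r i + psi ^ k))"
          unfolding phase_def using A c(2) by (simp add: algebra_simps)
        also have "(\<Sum>i\<in>A. of_int (\<sigma> i) * g L (x + c i * u + r i + psi ^ k)) =
            (\<Sum>i\<in>A. of_int (\<sigma> i) * g L (x + c i * u + r i)) + w"
          unfolding w_def of_int_sum sum.distrib[symmetric]
          by (intro sum.cong refl) (use gA in \<open>simp add: algebra_simps\<close>)
        also have "of_int (\<sigma> j) * g L (x + r j + psi ^ k) + \<dots> =
            phase (insert j A) \<sigma> c r L x u + (w + of_int (\<sigma> j) * s)"
          unfolding phase_def gj using A c(2) by (simp add: algebra_simps)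
        finally show ?thesis unfolding F_def by (simp add: distrib_left e_add mult.commute)
      qed
      moreover have "x0 + h \<le> \<xi>'" "\<xi>' + 2 * h + psi ^ k \<le> x1"
        using 1 h unfolding \<xi>'_def by (auto split: if_splits)
      moreover have "\<forall>u\<in>{\<upsilon>..<\<upsilon> + h}. \<forall>x\<in>{\<xi>'..<\<xi>' + h}.
          F (x + psi ^ k) u = e (\<theta> * (w + of_int (\<sigma> j) * s)) * F x u"
        using calculation(1) by blast
      ultimately show "\<exists>\<xi> \<upsilon> t w. x0 + h \<le> \<xi> \<and> \<xi> + 2 * h + t \<le> x1 \<and> 2 * h \<le> t \<and> u0 + h \<le> \<upsilon> \<and> \<upsilon> + 2 * h \<le> u1 \<and>
        cmod (1 + w) \<le> 2 - d\<^sup>2 / 4 \<and> (\<forall>u\<in>{\<upsilon>..<\<upsilon> + h}. \<forall>x\<in>{\<xi>..<\<xi> + h}. F (x + t) u = w * F x u)"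
        using 1 s(2)
        by (intro exI[of _ \<xi>'] exI[of _ \<upsilon>] exI[of _ "psi ^ k"]
            exI[of _ "e (\<theta> * (w + of_int (\<sigma> j) * s))"] conjI)
    qed simp
    then show ?case unfolding hH by (simp add: q_def F_def d_def H_def mult.commute)
  qed
  then show ?thesis using m(2) by blast
qed

lemma phase_unit_square_bound:
  fixes c :: "'i \<Rightarrow> real" and \<sigma> :: "'i \<Rightarrow> int"
  assumes A: "finite A" "j \<notin> A" and c: "\<forall>i\<in>A. 1 \<le> c i" "c j = 0" and \<sigma>: "\<bar>\<sigma> j\<bar> = 1"
  shows "\<exists>\<kappa>>0. \<exists>C>0. \<forall>L\<ge>9. \<forall>\<theta> r.
    cmod (bounded_kernel.rect_integral (\<lambda>x u. e (\<theta> * phase (insert j A) \<sigma> c r L x u)) 0 1 0 1)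
      \<le> C * exp (- \<kappa> * real L * (dist_nearest_int \<theta>)\<^sup>2)"
proof -
  obtain m where m: "m > 0" and bb: "\<forall>\<theta> r L n k. odd k \<longrightarrow> 3 \<le> k \<longrightarrow> k + n * m \<le> L \<longrightarrow>
    bounded_kernel.box_bound (\<lambda>x u. e (\<theta> * phase (insert j A) \<sigma> c r L x u))
      ((1 - (dist_nearest_int \<theta>)\<^sup>2 / 4 * (psi ^ m / 2)\<^sup>2) ^ n) (16 * psi ^ k)"
    using phase_box_bound[where A = A and c = c and j = j and \<sigma> = \<sigma>, OF A c \<sigma>] by (elim exE conjE) (rule that)
  define \<eta> where "\<eta> = (psi ^ m / 2)\<^sup>2 / 4"
  have \<eta>: "\<eta> > 0" using psi_bounds by (simp add: \<eta>_def)
  \<comment> \<open>Scale 9 is odd and has \<open>16 * psi ^ 9 \<le> 1\<close>, so the unit square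
    is large enough for the box bound.\<close>
  have "psi ^ 9 \<le> (2/3) ^ 9" using psi_bounds psi_le_two_thirds by (intro power_mono) auto
  also have "\<dots> \<le> (1/16 :: real)" by (simp add: power_divide)
  finally have psi9: "16 * psi ^ 9 \<le> 1" by simp
  have main: "cmod (bounded_kernel.rect_integral (\<lambda>x u. e (\<theta> * phase (insert j A) \<sigma> c r L x u)) 0 1 0 1)
      \<le> exp (10 * \<eta>) * exp (- (\<eta> / m) * real L * (dist_nearest_int \<theta>)\<^sup>2)" if L: "L \<ge> 9" for L \<theta> r
  proof -
    define F where "F = (\<lambda>x u. e (\<theta> * phase (insert j A) \<sigma> c r L x u))"
    interpret bounded_kernel F unfolding F_def by (rule bounded_kernel_phase)
    define d where "d = (dist_nearest_int \<theta>)\<^sup>2"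
    have d: "0 \<le> d" "d \<le> 1"
      using power_mono[OF dist_nearest_int_le_half dist_nearest_int_nonneg, of \<theta> 2]
      by (auto simp: d_def power2_eq_square)
    define n where "n = (L - 9) div m"
    have nm: "L - 9 = n * m + (L - 9) mod m" by (simp add: n_def)
    then have "9 + n * m \<le> L" using L by linarith
    then have "box_bound ((1 - d * \<eta>) ^ n) (16 * psi ^ 9)"
      using bb[rule_format, of 9 n L \<theta> r] by (simp add: F_def d_def \<eta>_def)
    then have "cmod (rect_integral 0 1 0 1) \<le> (1 - d * \<eta>) ^ n"
      using psi9 unfolding box_bound_def by (metis diff_zero mult_1_right)
    also have "\<dots> \<le> exp (- (d * \<eta>)) ^ n"
    proof (rule power_mono)
      show "1 - d * \<eta> \<le> exp (- (d * \<eta>))" using exp_ge_add_one_self[of "- (d * \<eta>)"] by simp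
      have "psi ^ m \<le> 1" using psi_bounds by (intro power_le_one) auto
      then have "(psi ^ m / 2)\<^sup>2 \<le> (1/2)\<^sup>2" using psi_bounds by (intro power_mono) auto
      then have "\<eta> \<le> 1" by (simp add: \<eta>_def power2_eq_square)
      then have "d * \<eta> \<le> 1 * 1" using d \<eta> by (intro mult_mono) auto
      then show "0 \<le> 1 - d * \<eta>" by simp
    qed
    also have "\<dots> = exp (- (d * \<eta>) * real n)" by (simp add: exp_of_nat_mult[symmetric] mult.commute)
    also have "\<dots> \<le> exp (10 * \<eta> - (\<eta> / m) * real L * d)"
    proof -
      \<comment> \<open>Rounding in \<open>n\<close> and the start at 9 lose at most
        \<open>10 * m\<close>, absorbed by the constant \<open>exp (10 * \<eta>)\<close>.\<close>
      have "(L - 9) mod m < m" using m by simp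
      then have "L < n * m + m + 9" using nm L by linarith
      then have "real L \<le> real (n * m + m + 9)" by linarith
      also have "\<dots> \<le> (real n + 10) * real m" using m by (simp add: algebra_simps)
      finally have "real L / real m \<le> real n + 10" using m by (simp add: field_simps)
      then have "(\<eta> * d) * (real L / real m) \<le> (\<eta> * d) * (real n + 10)"
        using \<eta> d by (intro mult_left_mono) auto
      moreover have "\<eta> * d * 10 \<le> \<eta> * 1 * 10" using d \<eta> by (intro mult_right_mono mult_left_mono) auto
      ultimately show ?thesis by (simp add: algebra_simps)
    qed
    also have "\<dots> = exp (10 * \<eta>) * exp (- (\<eta> / m) * real L * d)" by (simp add: exp_add[symmetric])
    finally show ?thesis by (simp add: F_def d_def)
  qed
  show ?thesis
    using main \<eta> m by (intro exI[of _ "\<eta> / m"] conjI exI[of _ "exp (10 * \<eta>)"]) auto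
qed

section \<open>The Gowers integral\<close>

lemma set_integral_swap:
  fixes f :: "'a \<Rightarrow> 'b \<Rightarrow> complex"
  assumes M: "sigma_finite_measure M" "sigma_finite_measure N"
    and A: "A \<in> sets M" "emeasure M A < \<infinity>" and B: "B \<in> sets N" "emeasure N B < \<infinity>"
    and f: "(\<lambda>(x, y). f x y) \<in> borel_measurable (M \<Otimes>\<^sub>M N)" and bound: "\<And>x y. cmod (f x y) \<le> K"
  shows "(LINT x:A|M. LINT y:B|N. f x y) = (LINT y:B|N. LINT x:A|M. f x y)"
proof -
  interpret M: sigma_finite_measure M by fact
  interpret N: sigma_finite_measure N by fact
  interpret pair_sigma_finite M N ..
  define F where "F x y = indicator A x *\<^sub>R (indicator B y *\<^sub>R f x y)" for x y
  have "integrable (M \<Otimes>\<^sub>M N) (\<lambda>z. indicator (A \<times> B) z *\<^sub>R (case z of (x, y) \<Rightarrow> f x y))"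
  proof (rule integrableI_bounded_set_indicator[where B = K])
    show "A \<times> B \<in> sets (M \<Otimes>\<^sub>M N)" using A B by blast
    show "emeasure (M \<Otimes>\<^sub>M N) (A \<times> B) < \<infinity>"
      using A B by (simp add: N.emeasure_pair_measure_Times ennreal_mult_less_top)
  qed (use f bound in \<open>auto split: prod.split\<close>)
  also have "(\<lambda>z. indicator (A \<times> B) z *\<^sub>R (case z of (x, y) \<Rightarrow> f x y)) = case_prod F"
    by (auto simp: F_def indicator_def fun_eq_iff)
  finally have "(\<integral>y. (\<integral>x. F x y \<partial>M) \<partial>N) = (\<integral>x. (\<integral>y. F x y \<partial>N) \<partial>M)"
    by (rule Fubini_integral)
  moreover have "(\<integral>x. (\<integral>y. F x y \<partial>N) \<partial>M) = (LINT x:A|M. LINT y:B|N. f x y)"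
    unfolding F_def set_lebesgue_integral_def by (simp del: scaleR_scaleR)
  moreover have "(\<integral>y. (\<integral>x. F x y \<partial>M) \<partial>N) = (LINT y:B|N. LINT x:A|M. f x y)"
  proof -
    have "F x y = indicator B y *\<^sub>R (indicator A x *\<^sub>R f x y)" for x y
      by (simp add: F_def mult.commute)
    then show ?thesis unfolding set_lebesgue_integral_def by (simp del: scaleR_scaleR)
  qed
  ultimately show ?thesis by simp
qed

lemma set_integral_unit_interval:
  fixes f :: "real \<Rightarrow> complex"
  assumes "f \<in> borel_measurable borel"
  shows "(LINT t:{0..1}|lborel. f t) = (LINT t:{0..<1}|lborel. f t)"
  unfolding set_lebesgue_integral_def
proof (rule integral_cong_AE)
  show "AE t in lborel. indicator {0..1} t *\<^sub>R f t = indicator {0..<1} t *\<^sub>R f t"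
    using AE_lborel_singleton[of 1] by eventually_elim (auto simp: indicator_def)
qed (use assms in auto)

lemma set_integral_periodic_shift:
  fixes f :: "real \<Rightarrow> complex"
  assumes f: "f \<in> borel_measurable borel" and bound: "\<And>t. cmod (f t) \<le> K"
    and per: "\<And>t. f (t + 1) = f t" and u: "0 \<le> u" "u \<le> 1"
  shows "(LINT t:{0..1}|lborel. f (t + u)) = (LINT t:{0..1}|lborel. f t)"
proof -
  have int: "set_integrable lborel {a..<b} f" if "a \<le> b" for a b
    by (rule set_integrable_interval[OF f bound that])
  have split: "(LINT t:{a..<c}|lborel. f t) = (LINT t:{a..<b}|lborel. f t) + (LINT t:{b..<c}|lborel. f t)"
    if "a \<le> b" "b \<le> c" for a b c
  proof -
    have "{a..<c} = {a..<b} \<union> {b..<c}" using that by auto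
    then show ?thesis by (simp only:) (rule set_integral_Un; (rule int)?; use that in auto)
  qed
  have fu: "(\<lambda>t. f (t + u)) \<in> borel_measurable borel" using f by measurable
  have "(LINT t:{0..1}|lborel. f (t + u)) = (LINT t:{u..<1 + u}|lborel. f t)"
    using set_integral_interval_shift[of 0 u 1 f] set_integral_unit_interval[OF fu] by simp
  also have "\<dots> = (LINT t:{u..<1}|lborel. f t) + (LINT t:{0 + 1..<u + 1}|lborel. f t)"
    using split[of u 1 "1 + u"] u by (simp add: add.commute)
  also have "(LINT t:{0 + 1..<u + 1}|lborel. f t) = (LINT t:{0..<u}|lborel. f t)"
    unfolding set_integral_interval_shift per ..
  also have "(LINT t:{u..<1}|lborel. f t) + \<dots> = (LINT t:{0..1}|lborel. f t)"
    using split[of 0 u 1] u set_integral_unit_interval[OF f] by simp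
  finally show ?thesis .
qed

section \<open>Translation invariance of integrals over the cube\<close>

interpretation lborel_product: product_sigma_finite "\<lambda>_. lborel :: real measure" ..

abbreviation cube :: "nat set \<Rightarrow> (nat \<Rightarrow> real) set" where
  "cube I \<equiv> I \<rightarrow>\<^sub>E {0..1}"

abbreviation cube_measure :: "nat set \<Rightarrow> (nat \<Rightarrow> real) measure" where
  "cube_measure I \<equiv> \<Pi>\<^sub>M i\<in>I. lborel"

lemma cube_in_sets: "finite I \<Longrightarrow> cube I \<in> sets (cube_measure I)"
  by (intro sets_PiM_I_finite) auto

lemma emeasure_cube: "finite I \<Longrightarrow> emeasure (cube_measure I) (cube I) = 1"
  by (subst lborel_product.emeasure_PiM) auto

lemma cube_integral_insert:
  fixes f :: "(nat \<Rightarrow> real) \<Rightarrow> complex"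
  assumes J: "finite J" "i \<notin> J" and f: "f \<in> borel_measurable (cube_measure (insert i J))"
    and bound: "\<And>y. cmod (f y) \<le> K"
  shows "(LINT y:cube (insert i J)|cube_measure (insert i J). f y) =
    (\<integral>x. indicator (cube J) x *\<^sub>R (LINT t:{0..1}|lborel. f (x(i := t))) \<partial>cube_measure J)"
proof -
  have fin: "finite (insert i J)" using J by simp
  have "set_integrable (cube_measure (insert i J)) (cube (insert i J)) f"
    by (rule set_integrable_bounded[OF cube_in_sets[OF fin] _ f bound]) (simp add: emeasure_cube[OF fin])
  then have "(LINT y:cube (insert i J)|cube_measure (insert i J). f y) =
      (\<integral>x. (\<integral>t. indicator (cube (insert i J)) (x(i := t)) *\<^sub>R f (x(i := t)) \<partial>lborel) \<partial>cube_measure J)"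
    unfolding set_lebesgue_integral_def set_integrable_def
    by (rule lborel_product.product_integral_insert[OF J])
  also have "\<dots> = (\<integral>x. indicator (cube J) x *\<^sub>R (LINT t:{0..1}|lborel. f (x(i := t))) \<partial>cube_measure J)"
  proof (rule Bochner_Integration.integral_cong[OF refl])
    fix x assume "x \<in> space (cube_measure J)"
    then have ext: "x \<in> extensional J" by (simp add: space_PiM PiE_def)
    have "x(i := t) \<in> cube (insert i J) \<longleftrightarrow> x \<in> cube J \<and> t \<in> {0..1}" for t
      using J ext by (auto simp: PiE_def Pi_def extensional_def)
    then have "indicator (cube (insert i J)) (x(i := t)) *\<^sub>R f (x(i := t)) =
        indicator (cube J) x *\<^sub>R (indicator {0..1} t *\<^sub>R f (x(i := t)))" for t
      by (auto simp: indicator_def)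
    then show "(\<integral>t. indicator (cube (insert i J)) (x(i := t)) *\<^sub>R f (x(i := t)) \<partial>lborel) =
        indicator (cube J) x *\<^sub>R (LINT t:{0..1}|lborel. f (x(i := t)))"
      unfolding set_lebesgue_integral_def by (simp del: scaleR_scaleR)
  qed
  finally show ?thesis .
qed

lemma cube_integral_shift_coordinate:
  fixes f :: "(nat \<Rightarrow> real) \<Rightarrow> complex"
  assumes I: "finite I" "i \<in> I" and f: "f \<in> borel_measurable (cube_measure I)"
    and bound: "\<And>y. cmod (f y) \<le> K" and per: "\<And>y. f (y(i := y i + 1)) = f y" and u: "0 \<le> u" "u \<le> 1"
  shows "(LINT y:cube I|cube_measure I. f (y(i := y i + u))) = (LINT y:cube I|cube_measure I. f y)"
proof -
  define J where "J = I - {i}"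
  have J: "finite J" "i \<notin> J" "I = insert i J" using I by (auto simp: J_def)
  have f': "(\<lambda>y. f (y(i := y i + u))) \<in> borel_measurable (cube_measure I)"
  proof (rule measurable_compose[OF _ f], rule measurable_fun_upd)
    show "I = I \<union> {i}" using I by auto
    have "(\<lambda>y. y i) \<in> borel_measurable (cube_measure I)"
      using measurable_component_singleton[OF I(2), of "\<lambda>_. lborel"] by simp
    then show "(\<lambda>y. y i + u) \<in> measurable (cube_measure I) lborel" by simp
  qed simp
  have inner: "(LINT t:{0..1}|lborel. f ((x(i := t))(i := (x(i := t)) i + u))) = (LINT t:{0..1}|lborel. f (x(i := t)))"
    if x: "x \<in> space (cube_measure J)" for x
  proof -
    have "(\<lambda>t. x(i := t)) \<in> measurable lborel (cube_measure I)"
      unfolding J(3) by (rule measurable_component_update[OF x J(2)])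
    then have "(\<lambda>t. f (x(i := t))) \<in> borel_measurable lborel" using f by (rule measurable_compose)
    then have "(\<lambda>t. f (x(i := t))) \<in> borel_measurable borel" by simp
    moreover have "f (x(i := t + 1)) = f (x(i := t))" for t using per[of "x(i := t)"] by simp
    ultimately have "(LINT t:{0..1}|lborel. f (x(i := t + u))) = (LINT t:{0..1}|lborel. f (x(i := t)))"
      by (intro set_integral_periodic_shift[where f = "\<lambda>t. f (x(i := t))" and K = K] bound u) auto
    then show ?thesis by simp
  qed
  have "(LINT y:cube I|cube_measure I. f (y(i := y i + u))) =
      (\<integral>x. indicator (cube J) x *\<^sub>R (LINT t:{0..1}|lborel. f ((x(i := t))(i := (x(i := t)) i + u))) \<partial>cube_measure J)"
    unfolding J(3) by (rule cube_integral_insert[OF J(1,2) _ bound]) (use f' J(3) in simp)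
  also have "\<dots> = (\<integral>x. indicator (cube J) x *\<^sub>R (LINT t:{0..1}|lborel. f (x(i := t))) \<partial>cube_measure J)"
    using inner by (intro Bochner_Integration.integral_cong) simp_all
  also have "\<dots> = (LINT y:cube I|cube_measure I. f y)"
    unfolding J(3) by (rule cube_integral_insert[OF J(1,2) _ bound, symmetric]) (use f J(3) in simp)
  finally show ?thesis .
qed

text \<open>One coordinate is translated at a time. Only those in \<open>I\<close> are moved, since
  points of the product space are \<open>undefined\<close> elsewhere.\<close>

lemma cube_integral_shift:
  fixes f :: "(nat \<Rightarrow> real) \<Rightarrow> complex"
  assumes I: "finite I" and f: "f \<in> borel_measurable (cube_measure I)"
    and bound: "\<And>y. cmod (f y) \<le> K" and per: "\<And>i y. i \<in> I \<Longrightarrow> f (y(i := y i + 1)) = f y"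
    and u: "0 \<le> u" "u \<le> 1"
  shows "(LINT y:cube I|cube_measure I. f (\<lambda>k. if k \<in> I then y k + u else y k)) =
    (LINT y:cube I|cube_measure I. f y)"
proof -
  define T where "T J y = (\<lambda>k. if k \<in> J then y k + u else (y k :: real))" for J :: "nat set" and y
  have "(LINT y:cube I|cube_measure I. f (T J y)) = (LINT y:cube I|cube_measure I. f y)"
    if "finite J" "J \<subseteq> I" for J
    using that
  proof (induction J rule: finite_induct)
    case empty
    then show ?case by (simp add: T_def)
  next
    case (insert i J)
    have meas: "(\<lambda>y. f (T J y)) \<in> borel_measurable (cube_measure I)"
    proof (rule measurable_compose[OF _ f], unfold T_def, rule measurable_PiM_single')
      fix k assume k: "k \<in> I"
      have "(\<lambda>y. y k) \<in> borel_measurable (cube_measure I)"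
        using measurable_component_singleton[OF k, of "\<lambda>_. lborel"] by simp
      then show "(\<lambda>y. if k \<in> J then y k + u else y k) \<in> measurable (cube_measure I) lborel" by simp
    next
      show "(\<lambda>y k. if k \<in> J then y k + u else y k) \<in> space (cube_measure I) \<rightarrow> (\<Pi>\<^sub>E i\<in>I. space lborel)"
        using insert.prems by (auto simp: space_PiM PiE_def extensional_def)
    qed
    have T: "T J (y(i := y i + a)) = (T J y)(i := T J y i + a)" for y a
      using insert.hyps by (auto simp: T_def fun_eq_iff)
    have "T (insert i J) y = T J (y(i := y i + u))" for y
      using insert.hyps by (auto simp: T_def fun_eq_iff)
    then have "(LINT y:cube I|cube_measure I. f (T (insert i J) y)) =
        (LINT y:cube I|cube_measure I. f (T J (y(i := y i + u))))" by simp
    also have "\<dots> = (LINT y:cube I|cube_measure I. f (T J y))"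
      by (rule cube_integral_shift_coordinate[OF I _ meas bound _ u])
         (use insert.prems per T in auto)
    finally show ?case using insert by simp
  qed
  from this[OF I subset_refl] show ?thesis by (simp add: T_def)
qed

lemma funpow_cnj_e: "(cnj ^^ n) (e t) = e ((-1) ^ n * t)"
  by (induction n) (simp_all add: cnj_e)

text \<open>The integral over the cube does not change when all coordinates of \<open>y\<close> are
  translated by \<open>u\<close>. Averaging over \<open>u\<close> and exchanging the integrals
  leaves, for each fixed \<open>y\<close>, a two-dimensional integral with shifts
  \<open>r y\<close>, which \<open>B\<close> bounds; the cube has measure 1.\<close>

lemma gowers_integral_le:
  fixes s L :: nat and \<theta> :: real
  defines "V \<equiv> {1..s} \<rightarrow>\<^sub>E {0, 1::nat}"
  defines "\<sigma> \<equiv> \<lambda>\<epsilon>. (-1) ^ (\<Sum>i\<in>{1..s}. \<epsilon> i)" and "c \<equiv> \<lambda>\<epsilon>. real (\<Sum>i\<in>{1..s}. \<epsilon> i)"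
  assumes B: "\<And>r. cmod (bounded_kernel.rect_integral (\<lambda>x u. e (\<theta> * phase V \<sigma> c r L x u)) 0 1 0 1) \<le> B"
  shows "cmod (gowers_integral s (\<lambda>x. e (\<theta> * g L x))) \<le> B"
proof -
  define I where "I = {1..s}"
  have I: "finite I" by (simp add: I_def)
  have finV: "finite V" unfolding V_def by (intro finite_PiE) auto
  define r where "r y \<epsilon> = (\<Sum>i\<in>I. y i * real (\<epsilon> i))" for y :: "nat \<Rightarrow> real" and \<epsilon> :: "nat \<Rightarrow> nat"
  define K where "K y x u = e (\<theta> * phase V \<sigma> c (r y) L x u)" for y x u
  have norm_K: "cmod (K y x u) \<le> 1" for y x u by (simp add: K_def)
  have r_meas [measurable]: "(\<lambda>y. r y \<epsilon>) \<in> borel_measurable (cube_measure I)" for \<epsilon>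
  proof -
    have "(\<lambda>y. y i) \<in> borel_measurable (cube_measure I)" if "i \<in> I" for i
      using measurable_component_singleton[OF that, of "\<lambda>_. lborel"] by simp
    then show ?thesis unfolding r_def by measurable
  qed
  have integrand: "(\<Prod>\<epsilon>\<in>V. (cnj ^^ (\<Sum>i\<in>{1..s}. \<epsilon> i))
      (e (\<theta> * g L (x + (\<Sum>i\<in>{1..s}. y i * real (\<epsilon> i)))))) = K y x 0" for x y
    unfolding K_def phase_def sum_distrib_left e_sum[OF finV]
    by (intro prod.cong refl) (simp add: funpow_cnj_e \<sigma>_def r_def I_def algebra_simps)
  have G: "gowers_integral s (\<lambda>x. e (\<theta> * g L x)) =
      (LINT x:{0..1}|lborel. LINT y:cube I|cube_measure I. K y x 0)"
    unfolding gowers_integral_def V_def[symmetric] integrand I_def ..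
  have shift: "r (\<lambda>k. if k \<in> I then y k + u else y k) \<epsilon> = c \<epsilon> * u + r y \<epsilon>" for y u \<epsilon>
    unfolding r_def c_def I_def of_nat_sum sum_distrib_right sum.distrib[symmetric]
    by (intro sum.cong refl) (simp add: algebra_simps)
  have K_shift: "K (\<lambda>k. if k \<in> I then y k + u else y k) x 0 = K y x u" for y x u
    unfolding K_def phase_def shift by (simp add: algebra_simps)
  \<comment> \<open>Raising \<open>y i\<close> by 1 moves each vertex by the integer
    \<open>\<epsilon> i\<close>, and \<open>g L\<close> has period 1.\<close>
  have K_per: "K (y(i := y i + 1)) x 0 = K y x 0" if "i \<in> I" for y i x
  proof -
    have "r (y(i := y i + 1)) \<epsilon> = r y \<epsilon> + of_int (int (\<epsilon> i))" for \<epsilon>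
      unfolding r_def using that I by (simp add: sum.remove[of I i] algebra_simps)
    then have "g L (x + c \<epsilon> * 0 + r (y(i := y i + 1)) \<epsilon>) = g L (x + c \<epsilon> * 0 + r y \<epsilon>)" for \<epsilon>
      using g_add_int[of L "x + c \<epsilon> * 0 + r y \<epsilon>" "int (\<epsilon> i)"] by (simp add: add.assoc)
    then show ?thesis by (simp add: K_def phase_def)
  qed
  interpret kernel: bounded_kernel "K y" for y
    unfolding K_def by (rule bounded_kernel_phase)
  have sf: "sigma_finite_measure (cube_measure I)"
    using lborel_product.sigma_finite[OF I] .
  have cube: "cube I \<in> sets (cube_measure I)" "emeasure (cube_measure I) (cube I) < \<infinity>"
    using cube_in_sets[OF I] emeasure_cube[OF I] by auto
  have row_meas: "(\<lambda>(u, y). kernel.row_integral y 0 1 u) \<in> borel_measurable (lborel \<Otimes>\<^sub>M cube_measure I)"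
  proof -
    have "(\<lambda>(z, x). indicator {0..<1} x *\<^sub>R K (snd z) x (fst z))
        \<in> borel_measurable ((lborel \<Otimes>\<^sub>M cube_measure I) \<Otimes>\<^sub>M lborel)"
      unfolding K_def phase_def by measurable
    then have "(\<lambda>z. \<integral>x. indicator {0..<1} x *\<^sub>R K (snd z) x (fst z) \<partial>lborel)
        \<in> borel_measurable (lborel \<Otimes>\<^sub>M cube_measure I)"
      by (rule lborel.borel_measurable_lebesgue_integral)
    then show ?thesis unfolding kernel.row_integral_def set_lebesgue_integral_def
      by (simp add: case_prod_beta')
  qed
  have avg: "gowers_integral s (\<lambda>x. e (\<theta> * g L x)) =
      (LINT y:cube I|cube_measure I. kernel.row_integral y 0 1 u)" if u: "u \<in> {0..<1}" for u
  proof -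
    have "(LINT y:cube I|cube_measure I. K y x 0) = (LINT y:cube I|cube_measure I. K y x u)" for x
    proof -
      have "(\<lambda>y. K y x 0) \<in> borel_measurable (cube_measure I)"
        unfolding K_def phase_def by measurable
      from cube_integral_shift[OF I this norm_K K_per, of u] show ?thesis
        using u unfolding K_shift by simp
    qed
    then have "gowers_integral s (\<lambda>x. e (\<theta> * g L x)) =
        (LINT x:{0..1}|lborel. LINT y:cube I|cube_measure I. K y x u)" by (simp add: G)
    also have "\<dots> = (LINT y:cube I|cube_measure I. LINT x:{0..1}|lborel. K y x u)"
    proof (rule set_integral_swap[OF lborel.sigma_finite_measure_axioms sf _ _ cube _ norm_K])
      show "(\<lambda>(x, y). K y x u) \<in> borel_measurable (lborel \<Otimes>\<^sub>M cube_measure I)"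
        unfolding K_def phase_def by measurable
    qed auto
    also have "\<dots> = (LINT y:cube I|cube_measure I. kernel.row_integral y 0 1 u)"
      unfolding kernel.row_integral_def using set_integral_unit_interval[OF kernel.measurable_row] by simp
    finally show ?thesis .
  qed
  \<comment> \<open>A constant equals its mean over the unit interval; for each \<open>u\<close> it
    is then rewritten by \<open>avg\<close>.\<close>
  have "gowers_integral s (\<lambda>x. e (\<theta> * g L x)) =
      (LINT u:{0..<1::real}|lborel. gowers_integral s (\<lambda>x. e (\<theta> * g L x)))"
    by (simp add: set_lebesgue_integral_def)
  also have "\<dots> = (LINT u:{0..<1}|lborel. LINT y:cube I|cube_measure I. kernel.row_integral y 0 1 u)"
    by (rule set_lebesgue_integral_cong) (use avg in auto)
  also have "\<dots> = (LINT y:cube I|cube_measure I. LINT u:{0..<1}|lborel. kernel.row_integral y 0 1 u)"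
  proof (rule set_integral_swap[OF lborel.sigma_finite_measure_axioms sf _ _ cube row_meas])
    show "cmod (kernel.row_integral y 0 1 u) \<le> 1" for u y
      using kernel.norm_row_integral_le[of 0 1 y u] by simp
  qed auto
  also have "\<dots> = (LINT y:cube I|cube_measure I. kernel.rect_integral y 0 1 0 1)"
    by (simp add: kernel.rect_integral_def)
  finally have eq: "gowers_integral s (\<lambda>x. e (\<theta> * g L x)) =
      (LINT y:cube I|cube_measure I. kernel.rect_integral y 0 1 0 1)" .
  have "(\<lambda>y. kernel.rect_integral y 0 1 0 1) \<in> borel_measurable (cube_measure I)"
  proof -
    have "(\<lambda>(y, u). indicator {0..<1} u *\<^sub>R kernel.row_integral y 0 1 u) \<in> borel_measurable (cube_measure I \<Otimes>\<^sub>M lborel)"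
      using measurable_compose[OF measurable_pair_swap' row_meas]
      by (simp add: case_prod_beta') measurable
    then show ?thesis unfolding kernel.rect_integral_def set_lebesgue_integral_def
      by (rule lborel.borel_measurable_lebesgue_integral)
  qed
  moreover have "cmod (kernel.rect_integral y 0 1 0 1) \<le> B" for y
  proof -
    have "K y = (\<lambda>x u. e (\<theta> * phase V \<sigma> c (r y) L x u))" by (simp add: K_def fun_eq_iff)
    then show ?thesis using B[of "r y"] by (simp only:)
  qed
  ultimately have "cmod (LINT y:cube I|cube_measure I. kernel.rect_integral y 0 1 0 1)
      \<le> B * measure (cube_measure I) (cube I)"
    by (intro norm_set_integral_le[OF cube]) auto
  then show ?thesis unfolding eq using emeasure_cube[OF I] by (simp add: measure_def)
qed

theorem theorem5p7:
  fixes s :: nat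
  assumes "s \<ge> 1"
  shows "\<exists>c>0. \<exists>C>0. \<forall>\<^sub>F L in sequentially. \<forall>\<theta>::real.
           gowers_norm s (\<lambda>x. e (\<theta> * g L x)) ^ (2 ^ s)
             \<le> C * exp (- c * real L * (dist_nearest_int \<theta>)\<^sup>2)"
proof -
  define V where "V = {1..s} \<rightarrow>\<^sub>E {0, 1::nat}"
  define \<sigma> :: "(nat \<Rightarrow> nat) \<Rightarrow> int" where "\<sigma> = (\<lambda>\<epsilon>. (-1) ^ (\<Sum>i\<in>{1..s}. \<epsilon> i))"
  define c :: "(nat \<Rightarrow> nat) \<Rightarrow> real" where "c = (\<lambda>\<epsilon>. real (\<Sum>i\<in>{1..s}. \<epsilon> i))"
  \<comment> \<open>The zero vertex, \<open>undefined\<close> outside \<open>{1..s}\<close> so that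
    it belongs to \<open>V\<close>. It is the only vertex that does not move with
    \<open>u\<close>.\<close>
  define j :: "nat \<Rightarrow> nat" where "j = (\<lambda>i\<in>{1..s}. 0)"
  define A where "A = V - {j}"
  have j: "j \<in> V" by (simp add: j_def V_def)
  have V: "V = insert j A" using j by (auto simp: A_def)
  have "finite V" unfolding V_def by (intro finite_PiE) auto
  then have A: "finite A" "j \<notin> A" by (auto simp: A_def)
  have "\<forall>\<epsilon>\<in>A. 1 \<le> c \<epsilon>"
  proof
    fix \<epsilon> assume \<epsilon>: "\<epsilon> \<in> A"
    have "\<exists>i\<in>{1..s}. \<epsilon> i \<noteq> 0"
    proof (rule ccontr)
      assume "\<not> ?thesis"
      then have "\<epsilon> = j" using \<epsilon> by (intro ext) (auto simp: j_def A_def V_def PiE_def extensional_def)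
      then show False using \<epsilon> A by simp
    qed
    then have "(\<Sum>i\<in>{1..s}. \<epsilon> i) \<noteq> 0" by simp
    then show "1 \<le> c \<epsilon>" by (simp only: c_def)
  qed
  moreover have "c j = 0" by (simp add: c_def j_def)
  moreover have "\<bar>\<sigma> j\<bar> = 1" by (simp add: \<sigma>_def power_abs)
  ultimately obtain \<kappa> C where kC: "\<kappa> > 0" "C > 0" and bound: "\<forall>L\<ge>9. \<forall>\<theta> r.
      cmod (bounded_kernel.rect_integral (\<lambda>x u. e (\<theta> * phase V \<sigma> c r L x u)) 0 1 0 1)
        \<le> C * exp (- \<kappa> * real L * (dist_nearest_int \<theta>)\<^sup>2)"
    using phase_unit_square_bound[OF A, of c \<sigma>] unfolding V by blast
  have "gowers_norm s (\<lambda>x. e (\<theta> * g L x)) ^ (2 ^ s) \<le> C * exp (- \<kappa> * real L * (dist_nearest_int \<theta>)\<^sup>2)"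
    if "9 \<le> L" for L \<theta>
  proof -
    have "gowers_norm s (\<lambda>x. e (\<theta> * g L x)) ^ (2 ^ s) = cmod (gowers_integral s (\<lambda>x. e (\<theta> * g L x)))"
      unfolding gowers_norm_def by (rule real_root_pow_pos2) auto
    also have "\<dots> \<le> C * exp (- \<kappa> * real L * (dist_nearest_int \<theta>)\<^sup>2)"
      by (rule gowers_integral_le) (use bound that in \<open>simp add: V_def \<sigma>_def c_def\<close>)
    finally show ?thesis .
  qed
  then show ?thesis using kC unfolding eventually_sequentially by blast
qed

end
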